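(* Let $m\geqslant 3$ be an odd integer. Then the number of distinct $C_4$-face-magic projective labelings on $\mathcal{P}_{m,m}$, counted up to symmetries of the projective plane, is at least $\tau(m,m)\,2^{m-3}\Bigl(\bigl((\tfrac{m-1}{2})!\bigr)^2+2\bigl(\beta(m)\bigr)^2\Bigr)$.
   Context: $\mathcal{P}_{m,n}$ has vertices $(i,j)$, $1\leqslant i\leqslant m$, $1\leqslant j\leqslant n$, and edges $(i,j)$–$(i,j+1)$ ($j\leqslant n-1$), $(i,n)$–$(m+1-i,1)$, $(i,j)$–$(i+1,j)$ ($i\leqslant m-1$), $(m,j)$–$(1,n+1-j)$, embedded naturally in the projective plane. Its 4-cycle faces are $\{(i,j),(i+1,j),(i,j+1),(i+1,j+1)\}$ ($1\leqslant i\leqslant m-1$, $1\leqslant j\leqslant n-1$), $\{(i,n),(i+1,n),(m+1-i,1),(m-i,1)\}$ ($1\leqslant i\leqslant m-1$), $\{(m,j),(m,j+1),(1,n+1-j),(1,n-j)\}$ ($1\leqslant j\leqslant n-1$); the other two faces are digons. A $C_4$-face-magic projective labeling is a bijection from the vertices onto $\{1,\ldots,mn\}$ such that every 4-cycle face has the same label sum. For $\mathcal{P}_{m,m}$ the symmetries are the 8 elements of the dihedral group generated by the rotation $(i,j)\mapsto(m+1-j,i)$ and the reflection $(i,j)\mapsto(i,m+1-j)$; labelings are counted up to precomposition with these. For positive integer $k$, an $(m,n)$-projective factorization sequence is a tuple $(m_1,n_1,\ldots,m_k,n_k)$ of integers $>1$ with $m=m_1\cdots m_k$, $n=n_1\cdots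 n_k$, or a tuple $(m_1,n_1,\ldots,m_k,n_k,m_{k+1})$ of integers $>1$ with $m=m_1\cdots m_{k+1}$, $n=n_1\cdots n_k$; $\tau(m,n)$ is the number of distinct such sequences. For odd $m\geqslant3$, $\beta(m)=\bigl((\tfrac{m-1}{4})!\bigr)^2$ if $m\equiv1\pmod4$ and $\beta(m)=(\tfrac{m-3}{4})!\,(\tfrac{m+1}{4})!$ if $m\equiv3\pmod4$. *)

theory Defs
  imports "HOL-Algebra.Bij" "HOL-Algebra.Generated_Groups"
begin

definition proj_vertices :: "nat \<Rightarrow> nat \<Rightarrow> (nat \<times> nat) set" where
  "proj_vertices m n = {1..m} \<times> {1..n}"

text \<open>Only the 4-cycle faces of the projective grid; the two digonal faces carry no condition.\<close>

definition proj_C4_faces :: "nat \<Rightarrow> nat \<Rightarrow> (nat \<times> nat) set set" where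
  "proj_C4_faces m n =
     {{(i, j), (i + 1, j), (i, j + 1), (i + 1, j + 1)} | i j.
        1 \<le> i \<and> i \<le> m - 1 \<and> 1 \<le> j \<and> j \<le> n - 1}
   \<union> {{(i, n), (i + 1, n), (m + 1 - i, 1), (m - i, 1)} | i. 1 \<le> i \<and> i \<le> m - 1}
   \<union> {{(m, j), (m, j + 1), (1, n + 1 - j), (1, n - j)} | j. 1 \<le> j \<and> j \<le> n - 1}"

text \<open>Labelings are extensional, so that distinct labelings differ at some vertex.\<close>

definition C4_face_magic_labelings :: "nat \<Rightarrow> nat \<Rightarrow> (nat \<times> nat \<Rightarrow> nat) set" where
  "C4_face_magic_labelings m n =
     {f \<in> extensional (proj_vertices m n).
        bij_betw f (proj_vertices m n) {1..m * n} \<and>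
        (\<exists>S. \<forall>F \<in> proj_C4_faces m n. (\<Sum>v\<in>F. f v) = S)}"

definition square_rotation :: "nat \<Rightarrow> nat \<times> nat \<Rightarrow> nat \<times> nat" where
  "square_rotation m = (\<lambda>(i, j) \<in> proj_vertices m m. (m + 1 - j, i))"

definition square_reflection :: "nat \<Rightarrow> nat \<times> nat \<Rightarrow> nat \<times> nat" where
  "square_reflection m = (\<lambda>(i, j) \<in> proj_vertices m m. (i, m + 1 - j))"

definition square_symmetries :: "nat \<Rightarrow> (nat \<times> nat \<Rightarrow> nat \<times> nat) set" where
  "square_symmetries m =
     generate (BijGroup (proj_vertices m m)) {square_rotation m, square_reflection m}"

definition labeling_equiv ::
    "nat \<Rightarrow> ((nat \<times> nat \<Rightarrow> nat) \<times> (nat \<times> nat \<Rightarrow> nat)) set" where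
  "labeling_equiv m =
     {(f, g). f \<in> C4_face_magic_labelings m m \<and> g \<in> C4_face_magic_labelings m m \<and>
        (\<exists>s \<in> square_symmetries m. g = compose (proj_vertices m m) f s)}"

definition num_labelings_up_to_symmetry :: "nat \<Rightarrow> nat" where
  "num_labelings_up_to_symmetry m = card (C4_face_magic_labelings m m // labeling_equiv m)"

text \<open>A sequence \<open>(m\<^sub>1, n\<^sub>1, m\<^sub>2, n\<^sub>2, \<dots>)\<close> is a list: \<open>m\<^sub>i\<close> and \<open>n\<^sub>i\<close> have
  (zero-based) positions \<open>2 * (i - 1)\<close> and \<open>2 * (i - 1) + 1\<close>.\<close>

definition proj_factorization_seqs :: "nat \<Rightarrow> nat \<Rightarrow> nat list set" where
  "proj_factorization_seqs m n =
     {xs. (\<forall>x \<in> set xs. x > 1) \<and>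
        (\<exists>k \<ge> 1.
           length xs = 2 * k \<and>
             m = (\<Prod>i<k. xs ! (2 * i)) \<and> n = (\<Prod>i<k. xs ! (2 * i + 1))
         \<or> length xs = 2 * k + 1 \<and>
             m = (\<Prod>i<k + 1. xs ! (2 * i)) \<and> n = (\<Prod>i<k. xs ! (2 * i + 1)))}"

definition tau :: "nat \<Rightarrow> nat \<Rightarrow> nat" where
  "tau m n = card (proj_factorization_seqs m n)"

text \<open>Meant for odd \<open>m \<ge> 3\<close>, where all divisions are exact.\<close>

definition beta :: "nat \<Rightarrow> nat" where
  "beta m = (if m mod 4 = 1 then (fact ((m - 1) div 4))\<^sup>2
             else fact ((m - 3) div 4) * fact ((m + 1) div 4))"

end

theory Submission
  imports Defs
begin

text \<open>
  Put the origin at the central vertex of the \<open>m \<times> n\<close> grid, so that rows and columns are indexed by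
  \<open>D = {-h..h}\<close> and \<open>E = {-k..k}\<close> with \<open>m = 2h + 1\<close> and \<open>n = 2k + 1\<close>. If \<open>\<alpha>\<close> and \<open>\<beta>\<close> are odd
  functions on \<open>D\<close> and \<open>E\<close>, then every labeling whose value at \<open>(d, e)\<close> is \<open>p + w (\<alpha> d + \<beta> e)\<close> or
  \<open>q - w (\<alpha> d + \<beta> e)\<close>, according to the parity of \<open>d + e\<close>, has constant face sum \<open>2 (p + q)\<close>: on an
  inner face the sum_insert4 variable parts cancel, on a wrap-around face antipodal vertices cancel.

  Let \<open>N = (m n - 1) / 2\<close> and let \<open>A\<close>, \<open>B\<close> be symmetric integer sets with \<open>m\<close> and \<open>n\<close> elements and
  \<open>A \<oplus> B = {-N..N}\<close>. Any odd bijections \<open>\<alpha> : D \<rightarrow> A\<close>, \<open>\<beta> : E \<rightarrow> B\<close> yield the labeling with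
  \<open>p = q = N + 1\<close>, \<open>w = 1\<close>; antipodal vertices carry opposite values \<open>\<plusminus>v\<close>, so the parity-dependent
  sign only permutes labels. If \<open>\<alpha>\<close> and \<open>\<beta>\<close> preserve parity and \<open>N\<close> is even, then with \<open>w = 1/2\<close> the
  even and the odd sums can instead be sent to the lower and the upper half of \<open>{1..m n}\<close>, or vice
  versa. The parity classes of \<open>D\<close> and \<open>A\<close> have equal sizes because the sum of \<open>(-1)\<^sup>a\<close> over \<open>A\<close>
  divides the corresponding sum over \<open>{-N..N}\<close>, which is \<open>\<plusminus>1\<close>; this is the source of \<open>\<beta>(m)\<close>.

  A factorization sequence \<open>x\<^sub>1, x\<^sub>2, \<dots>\<close> gives a pair of tiles by writing integers in the mixed radix
  \<open>x\<^sub>1, x\<^sub>2, \<dots>\<close> with centered digits and letting \<open>A\<close> use the digits in odd, \<open>B\<close> those in even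
  positions. Exchanging the tiles gives \<open>2 \<tau>(m, m)\<close> pairs for \<open>m = n\<close>. Finally, a symmetry class has
  at most 8 elements.
\<close>

section \<open>Symmetry classes\<close>

lemma card_le_mult_card_quotient:
  assumes "r \<subseteq> A \<times> A" "refl_on A r" "\<And>x. x \<in> A \<Longrightarrow> card (r `` {x}) \<le> k"
  shows "card A \<le> k * card (A // r)"
proof -
  have "A = \<Union> (A // r)"
    using assms(1,2) by (auto simp: quotient_def refl_on_def)
  hence "card A \<le> (\<Sum>C\<in>A // r. card C)"
    by (metis card_Union_le_sum_card)
  also have "\<dots> \<le> (\<Sum>C\<in>A // r. k)"
    by (rule sum_mono) (auto simp: quotient_def assms(3))
  finally show ?thesis
    by (simp add: mult.commute)
qed

definition reflect :: "nat \<Rightarrow> bool \<Rightarrow> nat \<Rightarrow> nat" where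
  "reflect m a i = (if a then m + 1 - i else i)"

lemma reflect_mem: "i \<in> {1..m} \<Longrightarrow> reflect m a i \<in> {1..m}"
  by (auto simp: reflect_def)

lemma reflect_reflect: "i \<in> {1..m} \<Longrightarrow> reflect m a (reflect m b i) = reflect m (a \<noteq> b) i"
  by (auto simp: reflect_def)

definition square_symmetry :: "nat \<Rightarrow> bool \<times> bool \<times> bool \<Rightarrow> nat \<times> nat \<Rightarrow> nat \<times> nat" where
  "square_symmetry m = (\<lambda>(t, a, b). \<lambda>(i, j)\<in>proj_vertices m m.
     if t then (reflect m a j, reflect m b i) else (reflect m a i, reflect m b j))"

lemma square_symmetry_mapsto:
  "square_symmetry m s \<in> proj_vertices m m \<rightarrow> proj_vertices m m"
  by (cases s) (auto simp: square_symmetry_def proj_vertices_def reflect_mem[simplified])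

lemma compose_square_symmetry:
  "compose (proj_vertices m m) (square_symmetry m (t, a, b)) (square_symmetry m (t', a', b')) =
     square_symmetry m (t \<noteq> t', a \<noteq> (if t then b' else a'), b \<noteq> (if t then a' else b'))"
proof (rule extensionalityI[of _ "proj_vertices m m"])
  fix v
  assume v: "v \<in> proj_vertices m m"
  hence "square_symmetry m (t', a', b') v \<in> proj_vertices m m"
    using square_symmetry_mapsto by blast
  with v show "compose (proj_vertices m m) (square_symmetry m (t, a, b))
      (square_symmetry m (t', a', b')) v =
    square_symmetry m (t \<noteq> t', a \<noteq> (if t then b' else a'), b \<noteq> (if t then a' else b')) v"
    by (cases t; cases t')
      (auto simp: compose_eq square_symmetry_def proj_vertices_def reflect_reflect)
qed (simp_all add: square_symmetry_def compose_extensional)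

lemma square_symmetry_id:
  "square_symmetry m (False, False, False) = (\<lambda>v\<in>proj_vertices m m. v)"
  by (rule ext) (auto simp: square_symmetry_def reflect_def)

lemma square_rotation_eq: "square_rotation m = square_symmetry m (True, True, False)"
  by (rule ext) (auto simp: square_rotation_def square_symmetry_def reflect_def)

lemma square_reflection_eq: "square_reflection m = square_symmetry m (False, False, True)"
  by (rule ext) (auto simp: square_reflection_def square_symmetry_def reflect_def)

lemma square_symmetry_Bij: "square_symmetry m s \<in> Bij (proj_vertices m m)"
proof (cases s)
  case (fields t a b)
  let ?V = "proj_vertices m m" and ?f = "square_symmetry m s"
  let ?g = "square_symmetry m (t, if t then b else a, if t then a else b)"
  have compose_inverse: "compose ?V ?g ?f = (\<lambda>v\<in>?V. v)" "compose ?V ?f ?g = (\<lambda>v\<in>?V. v)"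
    by (simp_all add: fields compose_square_symmetry square_symmetry_id)
  have "?g (?f v) = v" "?f (?g v) = v" if "v \<in> ?V" for v
    using fun_cong[OF compose_inverse(1), of v] fun_cong[OF compose_inverse(2), of v] that
    by (simp_all only: compose_eq restrict_apply')
  hence "bij_betw ?f ?V ?V"
    using square_symmetry_mapsto by (intro bij_betwI[where g = ?g]) auto
  thus ?thesis
    by (simp add: Bij_def square_symmetry_def fields)
qed

lemma subgroup_range_square_symmetry:
  "subgroup (range (square_symmetry m)) (BijGroup (proj_vertices m m))"
proof -
  let ?G = "BijGroup (proj_vertices m m)"
  interpret group ?G
    by (rule group_BijGroup)
  have carrier: "square_symmetry m s \<in> carrier ?G" for s
    by (simp add: BijGroup_def square_symmetry_Bij)
  have mult: "square_symmetry m (t, a, b) \<otimes>\<^bsub>?G\<^esub> square_symmetry m (t', a', b') =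
      square_symmetry m (t \<noteq> t', a \<noteq> (if t then b' else a'), b \<noteq> (if t then a' else b'))"
    for t a b t' a' b'
    by (simp add: BijGroup_def square_symmetry_Bij compose_square_symmetry)
  have inverse: "inv\<^bsub>?G\<^esub> (square_symmetry m (t, a, b)) =
      square_symmetry m (t, if t then b else a, if t then a else b)" for t a b
  proof (rule inv_equality)
    show "square_symmetry m (t, if t then b else a, if t then a else b) \<otimes>\<^bsub>?G\<^esub>
        square_symmetry m (t, a, b) = \<one>\<^bsub>?G\<^esub>"
      unfolding mult by (simp add: BijGroup_def flip: square_symmetry_id)
  qed (rule carrier)+
  show ?thesis
    by (rule subgroupI) (auto simp: carrier mult inverse)
qed

lemma square_symmetries_subset: "square_symmetries m \<subseteq> range (square_symmetry m)"
  unfolding square_symmetries_def square_rotation_eq square_reflection_eq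
  by (rule group.generate_subgroup_incl[OF group_BijGroup _ subgroup_range_square_symmetry]) blast

lemma card_labeling_class_le: "card (labeling_equiv m `` {f}) \<le> 8"
proof -
  have "labeling_equiv m `` {f} \<subseteq> range (\<lambda>s. compose (proj_vertices m m) f (square_symmetry m s))"
    using square_symmetries_subset[of m] by (fastforce simp: labeling_equiv_def)
  hence "card (labeling_equiv m `` {f}) \<le> card (UNIV :: (bool \<times> bool \<times> bool) set)"
    by (meson card_image_le card_mono finite finite_imageI order_trans)
  thus ?thesis
    by (simp add: card_UNIV_bool flip: UNIV_Times_UNIV)
qed

lemma refl_on_labeling_equiv: "refl_on (C4_face_magic_labelings m m) (labeling_equiv m)"
proof (rule refl_onI)
  fix f
  assume f: "f \<in> C4_face_magic_labelings m m"
  let ?V = "proj_vertices m m"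
  have "(\<lambda>v\<in>?V. v) \<in> square_symmetries m"
    using generate.one[of "BijGroup ?V"] by (simp add: square_symmetries_def BijGroup_def)
  moreover have "f = compose ?V f (\<lambda>v\<in>?V. v)"
    using f by (intro compose_Id[symmetric, where B = UNIV])
      (auto simp: C4_face_magic_labelings_def)
  ultimately show "(f, f) \<in> labeling_equiv m"
    using f unfolding labeling_equiv_def by blast
qed

lemma card_labelings_le:
  "card (C4_face_magic_labelings m m) \<le> 8 * num_labelings_up_to_symmetry m"
  unfolding num_labelings_up_to_symmetry_def
  by (rule card_le_mult_card_quotient[OF _ refl_on_labeling_equiv card_labeling_class_le])
    (auto simp: labeling_equiv_def)

lemma finite_C4_face_magic_labelings: "finite (C4_face_magic_labelings m n)"
proof (rule finite_subset)
  show "C4_face_magic_labelings m n \<subseteq> proj_vertices m n \<rightarrow>\<^sub>E {1..m * n}"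
    by (auto simp: C4_face_magic_labelings_def PiE_def dest: bij_betw_imp_funcset)
  show "finite (proj_vertices m n \<rightarrow>\<^sub>E {1..m * n})"
    by (intro finite_PiE) (auto simp: proj_vertices_def)
qed

section \<open>Odd bijections between symmetric sets\<close>

definition bijections :: "'a set \<Rightarrow> 'b set \<Rightarrow> ('a \<Rightarrow> 'b) set" where
  "bijections S T = {f \<in> S \<rightarrow>\<^sub>E T. bij_betw f S T}"

lemma bijectionsI: "bij_betw f S T \<Longrightarrow> f \<in> extensional S \<Longrightarrow> f \<in> bijections S T"
  by (auto simp: bijections_def PiE_def dest: bij_betw_imp_funcset)

lemma card_bijections:
  assumes "finite S" "finite T" "card S = card T"
  shows "card (bijections S T) = fact (card T)"
proof -
  have "bijections S T = {f \<in> S \<rightarrow>\<^sub>E T. inj_on f S}"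
  proof (intro equalityI subsetI)
    fix f
    assume f: "f \<in> {f \<in> S \<rightarrow>\<^sub>E T. inj_on f S}"
    hence "f ` S = T"
      using assms by (intro card_subset_eq) (auto simp: card_image)
    with f show "f \<in> bijections S T"
      by (simp add: bijections_def bij_betw_def)
  qed (auto simp: bijections_def bij_betw_def)
  thus ?thesis
    using card_inj_on_subset_funcset[OF assms(1,2) order_refl] assms(3) by (simp add: fact_prod_rev)
qed

definition fiber :: "('a \<Rightarrow> 'b) \<Rightarrow> 'a set \<Rightarrow> 'b \<Rightarrow> 'a set" where
  "fiber \<kappa> S c = {x \<in> S. \<kappa> x = c}"

definition bijections_preserving :: "('a \<Rightarrow> 'b) \<Rightarrow> 'a set \<Rightarrow> 'a set \<Rightarrow> ('a \<Rightarrow> 'a) set" where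
  "bijections_preserving \<kappa> S T = {f \<in> bijections S T. \<forall>x\<in>S. \<kappa> (f x) = \<kappa> x}"

lemma restrict_fiber_bijections:
  assumes "f \<in> bijections_preserving \<kappa> S T"
  shows "restrict f (fiber \<kappa> S c) \<in> bijections (fiber \<kappa> S c) (fiber \<kappa> T c)"
proof (rule bijectionsI)
  have f: "bij_betw f S T" and preserving: "\<forall>x\<in>S. \<kappa> (f x) = \<kappa> x"
    using assms by (auto simp: bijections_preserving_def bijections_def)
  have "f ` fiber \<kappa> S c = fiber \<kappa> T c"
    using preserving bij_betw_imp_surj_on[OF f] by (auto simp: fiber_def)
  thus "bij_betw (restrict f (fiber \<kappa> S c)) (fiber \<kappa> S c) (fiber \<kappa> T c)"
    using bij_betw_subset[OF f] by (simp add: fiber_def)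
qed simp

lemma glue_fibers_bijections_preserving:
  assumes g: "\<And>c. g c \<in> bijections (fiber \<kappa> S c) (fiber \<kappa> T c)"
  shows "(\<lambda>x\<in>S. g (\<kappa> x) x) \<in> bijections_preserving \<kappa> S T"
proof -
  define f where "f = (\<lambda>x\<in>S. g (\<kappa> x) x)"
  have bij: "bij_betw (g c) (fiber \<kappa> S c) (fiber \<kappa> T c)" for c
    using g by (simp add: bijections_def)
  have f: "f x \<in> T" and preserving: "\<kappa> (f x) = \<kappa> x" if "x \<in> S" for x
    using bij_betw_apply[OF bij, of x "\<kappa> x"] that by (simp_all add: fiber_def f_def)
  have "inj_on f S"
  proof (rule inj_onI)
    fix x y
    assume x: "x \<in> S" and y: "y \<in> S" and eq: "f x = f y"
    have "\<kappa> x = \<kappa> y"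
      using preserving[OF x] preserving[OF y] eq by simp
    with x y eq show "x = y"
      using inj_onD[OF bij_betw_imp_inj_on[OF bij[of "\<kappa> x"]], of x y]
      by (simp add: fiber_def f_def)
  qed
  moreover have "f ` S = T"
  proof (intro equalityI subsetI)
    fix y
    assume "y \<in> T"
    hence "y \<in> g (\<kappa> y) ` fiber \<kappa> S (\<kappa> y)"
      using bij_betw_imp_surj_on[OF bij] by (simp add: fiber_def)
    then obtain x where "x \<in> S" "\<kappa> x = \<kappa> y" "g (\<kappa> y) x = y"
      by (auto simp: fiber_def)
    thus "y \<in> f ` S"
      by (intro image_eqI[of y f x]) (simp_all add: f_def)
  qed (use f in auto)
  moreover have "f \<in> extensional S"
    by (simp add: f_def)
  ultimately show ?thesis
    using preserving by (simp add: bijections_preserving_def bijectionsI bij_betw_def flip: f_def)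
qed

lemma card_bijections_preserving:
  fixes \<kappa> :: "'a \<Rightarrow> 'b :: finite"
  assumes "finite S" "finite T" "\<And>c. card (fiber \<kappa> S c) = card (fiber \<kappa> T c)"
  shows "card (bijections_preserving \<kappa> S T) = (\<Prod>c\<in>UNIV. fact (card (fiber \<kappa> T c)))"
proof -
  let ?B = "\<lambda>c. bijections (fiber \<kappa> S c) (fiber \<kappa> T c)"
  have "bij_betw (\<lambda>f c. restrict f (fiber \<kappa> S c)) (bijections_preserving \<kappa> S T) (Pi\<^sub>E UNIV ?B)"
  proof (rule bij_betwI)
    show "(\<lambda>f c. restrict f (fiber \<kappa> S c)) \<in> bijections_preserving \<kappa> S T \<rightarrow> Pi\<^sub>E UNIV ?B"
      by (intro funcsetI PiE_I restrict_fiber_bijections) simp_all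
    show "(\<lambda>g. \<lambda>x\<in>S. g (\<kappa> x) x) \<in> Pi\<^sub>E UNIV ?B \<rightarrow> bijections_preserving \<kappa> S T"
      by (intro funcsetI glue_fibers_bijections_preserving) (erule PiE_mem, rule UNIV_I)
    show "(\<lambda>x\<in>S. restrict f (fiber \<kappa> S (\<kappa> x)) x) = f" if "f \<in> bijections_preserving \<kappa> S T" for f
      using that by (intro extensionalityI[of _ S])
        (auto simp: bijections_preserving_def bijections_def fiber_def PiE_def)
    show "(\<lambda>c. restrict (\<lambda>x\<in>S. g (\<kappa> x) x) (fiber \<kappa> S c)) = g" if "g \<in> Pi\<^sub>E UNIV ?B" for g
    proof
      fix c
      have "g c \<in> extensional (fiber \<kappa> S c)"
        using that by (auto simp: bijections_def PiE_def Pi_def)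
      thus "restrict (\<lambda>x\<in>S. g (\<kappa> x) x) (fiber \<kappa> S c) = g c"
        by (intro extensionalityI[of _ "fiber \<kappa> S c"]) (auto simp: fiber_def)
    qed
  qed
  hence "card (bijections_preserving \<kappa> S T) = (\<Prod>c\<in>UNIV. card (?B c))"
    by (simp add: bij_betw_same_card card_PiE)
  also have "\<dots> = (\<Prod>c\<in>UNIV. fact (card (fiber \<kappa> T c)))"
    using assms by (intro prod.cong card_bijections) (auto simp: fiber_def)
  finally show ?thesis .
qed

definition symmetric_set :: "'a :: uminus set \<Rightarrow> bool" where
  "symmetric_set A \<longleftrightarrow> (\<forall>a\<in>A. - a \<in> A)"

lemma uminus_mem_symmetric_set:
  fixes A :: "'a :: group_add set"
  shows "symmetric_set A \<Longrightarrow> - a \<in> A \<longleftrightarrow> a \<in> A"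
  unfolding symmetric_set_def by (metis minus_minus)

lemma abs_mem_symmetric_set:
  fixes A :: "'a :: linordered_idom set"
  shows "symmetric_set A \<Longrightarrow> \<bar>a\<bar> \<in> A \<longleftrightarrow> a \<in> A"
  by (simp add: abs_if uminus_mem_symmetric_set)

definition positives :: "'a :: {zero, ord} set \<Rightarrow> 'a set" where
  "positives A = {a \<in> A. 0 < a}"

lemma finite_positives: "finite A \<Longrightarrow> finite (positives A)"
  by (simp add: positives_def)

lemma abs_in_positives:
  fixes A :: "'a :: linordered_idom set"
  shows "symmetric_set A \<Longrightarrow> a \<in> A \<Longrightarrow> a \<noteq> 0 \<Longrightarrow> \<bar>a\<bar> \<in> positives A"
  by (simp add: positives_def abs_mem_symmetric_set)

lemma sum_symmetric_set:
  fixes f :: "'a :: linordered_ab_group_add \<Rightarrow> 'b :: semiring_1"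
  assumes "finite A" "symmetric_set A" "\<And>a. f (- a) = f a"
  shows "sum f A = (if 0 \<in> A then f 0 else 0) + 2 * sum f (positives A)"
proof -
  have A: "A = A \<inter> {0} \<union> (positives A \<union> uminus ` positives A)"
  proof (intro equalityI subsetI)
    fix a
    assume "a \<in> A"
    moreover have "a \<in> uminus ` positives A" if "a < 0"
      using that \<open>a \<in> A\<close> assms(2)
      by (intro image_eqI[of a uminus "- a"]) (auto simp: symmetric_set_def positives_def)
    ultimately show "a \<in> A \<inter> {0} \<union> (positives A \<union> uminus ` positives A)"
      by (cases a "0 :: 'a" rule: linorder_cases) (auto simp: positives_def)
  qed (use assms(2) in \<open>auto simp: symmetric_set_def positives_def\<close>)
  have finite: "finite (positives A)" "finite (uminus ` positives A)"
    using assms(1) by (simp_all add: finite_positives)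
  have "sum f A = sum f (A \<inter> {0}) + sum f (positives A \<union> uminus ` positives A)"
    by (subst (1) A, rule sum.union_disjoint) (use assms(1) finite in \<open>auto simp: positives_def\<close>)
  also have "sum f (positives A \<union> uminus ` positives A) =
      sum f (positives A) + sum f (uminus ` positives A)"
    by (rule sum.union_disjoint[OF finite]) (auto simp: positives_def)
  also have "sum f (uminus ` positives A) = sum f (positives A)"
    by (subst sum.reindex) (auto simp: assms(3))
  also have "sum f (A \<inter> {0}) = (if 0 \<in> A then f 0 else 0)"
    by (cases "0 \<in> A") auto
  finally show ?thesis
    by (simp add: mult_2)
qed

lemma finite_if_odd_card: "odd (card A) \<Longrightarrow> finite A"
  by (rule ccontr) simp

lemma odd_symmetric_set:
  fixes A :: "'a :: linordered_ab_group_add set"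
  assumes "symmetric_set A" "odd (card A)"
  shows "0 \<in> A" "card (positives A) = card A div 2"
proof -
  have "card A = (if 0 \<in> A then 1 else 0) + 2 * card (positives A)"
    using sum_symmetric_set[OF finite_if_odd_card[OF assms(2)] assms(1), of "\<lambda>_. 1 :: nat"]
    by (simp cong: if_cong)
  with assms(2) show "0 \<in> A" "card (positives A) = card A div 2"
    by (auto split: if_splits)
qed

definition odd_on :: "'a :: uminus set \<Rightarrow> ('a \<Rightarrow> 'b :: uminus) \<Rightarrow> bool" where
  "odd_on D f \<longleftrightarrow> (\<forall>d\<in>D. f (- d) = - f d)"

lemma odd_on_zero:
  fixes f :: "'a :: linordered_ab_group_add \<Rightarrow> 'b :: linordered_ab_group_add"
  assumes "odd_on D f" "0 \<in> D"
  shows "f 0 = 0"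
proof -
  have "f 0 = - f 0"
    using assms unfolding odd_on_def by (metis minus_zero)
  thus ?thesis
    by simp
qed

lemma abs_odd_on_abs:
  fixes f :: "'a :: linordered_idom \<Rightarrow> 'b :: linordered_idom"
  shows "odd_on D f \<Longrightarrow> d \<in> D \<Longrightarrow> \<bar>f \<bar>d\<bar>\<bar> = \<bar>f d\<bar>"
  by (simp add: odd_on_def abs_if)

lemma inj_on_abs_positives:
  fixes f :: "'a :: linordered_idom \<Rightarrow> 'b :: linordered_idom"
  assumes "symmetric_set D" "odd_on D f" "inj_on f D"
  shows "inj_on (\<lambda>d. \<bar>f d\<bar>) (positives D)"
proof (rule inj_onI)
  fix d e
  assume "d \<in> positives D" "e \<in> positives D" and eq: "\<bar>f d\<bar> = \<bar>f e\<bar>"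
  hence d: "d \<in> D" "0 < d" and e: "e \<in> D" "- e \<in> D" "0 < e"
    using assms(1) by (simp_all add: positives_def uminus_mem_symmetric_set)
  have "f d = f e \<or> f d = f (- e)"
    using eq assms(2) e(1) by (auto simp: abs_eq_iff odd_on_def)
  hence "d = e \<or> d = - e"
    using assms(3) d(1) e(1,2) by (blast dest: inj_onD)
  thus "d = e"
    using d(2) e(3) by auto
qed

lemma image_abs_positives:
  fixes f :: "'a :: linordered_idom \<Rightarrow> 'b :: linordered_idom"
  assumes D: "symmetric_set D" "0 \<in> D" and A: "symmetric_set A"
    and odd: "odd_on D f" and bij: "bij_betw f D A"
  shows "(\<lambda>d. \<bar>f d\<bar>) ` positives D = positives A"
proof (intro equalityI subsetI)
  fix a
  assume "a \<in> positives A"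
  then obtain d where d: "d \<in> D" "a = f d" "0 < a"
    using bij_betw_imp_surj_on[OF bij] by (auto simp: positives_def)
  hence "\<bar>d\<bar> \<in> positives D"
    using odd_on_zero[OF odd D(2)] by (intro abs_in_positives D) auto
  moreover have "a = \<bar>f \<bar>d\<bar>\<bar>"
    using d by (simp add: abs_odd_on_abs[OF odd])
  ultimately show "a \<in> (\<lambda>d. \<bar>f d\<bar>) ` positives D"
    by blast
next
  fix a
  assume "a \<in> (\<lambda>d. \<bar>f d\<bar>) ` positives D"
  then obtain d where d: "d \<in> D" "d \<noteq> 0" "a = \<bar>f d\<bar>"
    by (auto simp: positives_def)
  have "f d \<noteq> f 0"
    using inj_onD[OF bij_betw_imp_inj_on[OF bij], of d 0] d D(2) by blast
  thus "a \<in> positives A"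
    using d bij_betw_apply[OF bij d(1)] odd_on_zero[OF odd D(2)]
    by (simp add: positives_def abs_mem_symmetric_set[OF A])
qed

lemma bij_betw_abs_positives:
  fixes f :: "'a :: linordered_idom \<Rightarrow> 'b :: linordered_idom"
  assumes "symmetric_set D" "0 \<in> D" "symmetric_set A" "odd_on D f" "bij_betw f D A"
  shows "bij_betw (\<lambda>d. \<bar>f d\<bar>) (positives D) (positives A)"
  unfolding bij_betw_def
  using inj_on_abs_positives[OF assms(1,4) bij_betw_imp_inj_on[OF assms(5)]]
    image_abs_positives[OF assms] by blast

lemma inj_on_if_inj_on_abs_positives:
  fixes f :: "'a :: linordered_idom \<Rightarrow> 'b :: linordered_idom"
  assumes D: "symmetric_set D" "0 \<in> D" and odd: "odd_on D f"
    and inj: "inj_on (\<lambda>d. \<bar>f d\<bar>) (positives D)"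
    and nonzero: "\<And>d. d \<in> positives D \<Longrightarrow> f d \<noteq> 0"
  shows "inj_on f D"
proof (rule inj_onI)
  have f_eq_0_iff: "f d = 0 \<longleftrightarrow> d = 0" if "d \<in> D" for d
    using nonzero[OF abs_in_positives[OF D(1) that]] abs_odd_on_abs[OF odd that]
      odd_on_zero[OF odd D(2)] by (cases "d = 0") auto
  fix d e
  assume d: "d \<in> D" and e: "e \<in> D" and eq: "f d = f e"
  show "d = e"
  proof (cases "e = 0")
    case True
    thus ?thesis
      using f_eq_0_iff[OF d] f_eq_0_iff[OF e] eq by simp
  next
    case False
    moreover have "d \<noteq> 0"
      using False f_eq_0_iff[OF d] f_eq_0_iff[OF e] eq by simp
    ultimately have "\<bar>d\<bar> \<in> positives D" "\<bar>e\<bar> \<in> positives D"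
      using d e by (simp_all add: abs_in_positives[OF D(1)])
    moreover have "\<bar>f \<bar>d\<bar>\<bar> = \<bar>f \<bar>e\<bar>\<bar>"
      using d e eq by (simp add: abs_odd_on_abs[OF odd])
    ultimately have "\<bar>d\<bar> = \<bar>e\<bar>"
      using inj by (blast dest: inj_onD)
    moreover have "d \<noteq> - e"
      using odd e eq f_eq_0_iff[OF e] False by (auto simp: odd_on_def)
    ultimately show ?thesis
      by (simp add: abs_eq_iff)
  qed
qed

lemma image_if_image_abs_positives:
  fixes f :: "'a :: linordered_idom \<Rightarrow> 'b :: linordered_idom"
  assumes D: "symmetric_set D" "0 \<in> D" and A: "symmetric_set A" "0 \<in> A"
    and odd: "odd_on D f" and image: "(\<lambda>d. \<bar>f d\<bar>) ` positives D = positives A"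
  shows "f ` D = A"
proof (intro equalityI subsetI)
  fix a
  assume "a \<in> f ` D"
  then obtain d where d: "d \<in> D" "a = f d"
    by blast
  show "a \<in> A"
  proof (cases "d = 0")
    case False
    hence "\<bar>f \<bar>d\<bar>\<bar> \<in> positives A"
      using abs_in_positives[OF D(1) d(1)] image by blast
    thus ?thesis
      by (simp add: d abs_odd_on_abs[OF odd] positives_def abs_mem_symmetric_set[OF A(1)])
  qed (use d(2) A(2) odd_on_zero[OF odd D(2)] in simp)
next
  fix a
  assume a: "a \<in> A"
  show "a \<in> f ` D"
  proof (cases "a = 0")
    case False
    hence "\<bar>a\<bar> \<in> (\<lambda>d. \<bar>f d\<bar>) ` positives D"
      using image abs_in_positives[OF A(1) a] by simp
    then obtain d where d: "d \<in> D" "\<bar>f d\<bar> = \<bar>a\<bar>"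
      unfolding positives_def by auto
    hence "a = f d \<or> a = f (- d)"
      using odd by (auto simp: odd_on_def abs_eq_iff)
    thus ?thesis
      using D(1) d(1) by (auto simp: symmetric_set_def)
  qed (use odd_on_zero[OF odd D(2)] D(2) in force)
qed

lemma bij_betw_if_bij_betw_abs_positives:
  fixes f :: "'a :: linordered_idom \<Rightarrow> 'b :: linordered_idom"
  assumes D: "symmetric_set D" "0 \<in> D" and A: "symmetric_set A" "0 \<in> A"
    and odd: "odd_on D f" and bij: "bij_betw (\<lambda>d. \<bar>f d\<bar>) (positives D) (positives A)"
  shows "bij_betw f D A"
proof -
  have "f d \<noteq> 0" if "d \<in> positives D" for d
    using bij_betw_apply[OF bij that] by (simp add: positives_def)
  thus ?thesis
    using inj_on_if_inj_on_abs_positives[OF D odd] image_if_image_abs_positives[OF D A odd] bij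
    by (simp add: bij_betw_def)
qed

definition odd_bijections ::
    "('a :: linordered_idom \<Rightarrow> 'b) \<Rightarrow> 'a set \<Rightarrow> 'a set \<Rightarrow> ('a \<Rightarrow> 'a) set" where
  "odd_bijections \<kappa> D A = {f \<in> bijections_preserving \<kappa> D A. odd_on D f}"

definition odd_extension ::
    "'a :: linordered_idom set \<Rightarrow> ('a \<Rightarrow> 'a) \<times> 'a set \<Rightarrow> 'a \<Rightarrow> 'a" where
  "odd_extension D = (\<lambda>(p, S). \<lambda>d\<in>D. sgn d * (if \<bar>d\<bar> \<in> S then - p \<bar>d\<bar> else p \<bar>d\<bar>))"

lemma odd_on_odd_extension: "symmetric_set D \<Longrightarrow> odd_on D (odd_extension D (p, S))"
  by (simp add: odd_on_def odd_extension_def uminus_mem_symmetric_set)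

lemma abs_odd_extension:
  assumes "p \<in> positives D \<rightarrow> positives A" "d \<in> positives D"
  shows "\<bar>odd_extension D (p, S) d\<bar> = p d"
  using assms by (auto simp: odd_extension_def positives_def Pi_def)

lemma odd_extension_mem_odd_bijections:
  assumes D: "symmetric_set D" "0 \<in> D" and A: "symmetric_set A" "0 \<in> A"
    and even: "\<And>a. \<kappa> (- a) = \<kappa> a"
    and p: "p \<in> bijections_preserving \<kappa> (positives D) (positives A)"
  shows "odd_extension D (p, S) \<in> odd_bijections \<kappa> D A"
proof -
  define f where "f = odd_extension D (p, S)"
  have bij: "bij_betw p (positives D) (positives A)"
    and preserving: "\<forall>d\<in>positives D. \<kappa> (p d) = \<kappa> d"
    using p by (auto simp: bijections_preserving_def bijections_def)
  have odd: "odd_on D f"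
    using D(1) by (simp add: odd_on_odd_extension f_def)
  have abs_f: "\<bar>f d\<bar> = p d" if "d \<in> positives D" for d
    using abs_odd_extension[OF bij_betw_imp_funcset[OF bij] that] by (simp add: f_def)
  have even_abs: "\<kappa> \<bar>a\<bar> = \<kappa> a" for a
    by (simp add: abs_if even)
  have "bij_betw (\<lambda>d. \<bar>f d\<bar>) (positives D) (positives A)"
    using bij abs_f by (simp cong: bij_betw_cong)
  hence "bij_betw f D A"
    by (rule bij_betw_if_bij_betw_abs_positives[OF D A odd])
  moreover have "\<kappa> (f d) = \<kappa> d" if "d \<in> D" for d
  proof (cases "d = 0")
    case False
    hence "\<bar>d\<bar> \<in> positives D"
      by (rule abs_in_positives[OF D(1) that])
    hence "\<kappa> \<bar>f \<bar>d\<bar>\<bar> = \<kappa> \<bar>d\<bar>"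
      using abs_f preserving by simp
    thus ?thesis
      by (simp add: abs_odd_on_abs[OF odd that] even_abs)
  qed (use odd_on_zero[OF odd D(2)] in simp)
  moreover have "f \<in> extensional D"
    by (simp add: f_def odd_extension_def)
  ultimately show ?thesis
    using odd by (simp add: odd_bijections_def bijections_preserving_def bijectionsI flip: f_def)
qed

definition odd_restriction ::
    "'a :: linordered_idom set \<Rightarrow> ('a \<Rightarrow> 'a) \<Rightarrow> ('a \<Rightarrow> 'a) \<times> 'a set" where
  "odd_restriction D f = (\<lambda>d\<in>positives D. \<bar>f d\<bar>, {d \<in> positives D. f d < 0})"

lemma odd_restriction_mem_bijections_preserving:
  assumes D: "symmetric_set D" "0 \<in> D" and A: "symmetric_set A"
    and even: "\<And>a. \<kappa> (- a) = \<kappa> a" and f: "f \<in> odd_bijections \<kappa> D A"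
  shows "odd_restriction D f \<in>
    bijections_preserving \<kappa> (positives D) (positives A) \<times> Pow (positives D)"
proof -
  have odd: "odd_on D f" and bij: "bij_betw f D A" and preserving: "\<forall>d\<in>D. \<kappa> (f d) = \<kappa> d"
    using f by (auto simp: odd_bijections_def bijections_preserving_def bijections_def)
  have "\<kappa> \<bar>f d\<bar> = \<kappa> d" if "d \<in> D" for d
    using preserving even that by (simp add: abs_if)
  thus ?thesis
    using bij_betw_abs_positives[OF D A odd bij]
    by (auto simp: odd_restriction_def bijections_preserving_def positives_def intro!: bijectionsI)
qed

lemma odd_extension_odd_restriction:
  assumes D: "symmetric_set D" "0 \<in> D" and odd: "odd_on D f" and ext: "f \<in> extensional D"
  shows "odd_extension D (odd_restriction D f) = f"
proof (rule extensionalityI[of _ D])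
  fix d
  assume d: "d \<in> D"
  show "odd_extension D (odd_restriction D f) d = f d"
  proof (cases "d = 0")
    case False
    hence "\<bar>d\<bar> \<in> positives D"
      by (rule abs_in_positives[OF D(1) d])
    hence "odd_extension D (odd_restriction D f) d = sgn d * f \<bar>d\<bar>"
      using d by (simp add: odd_extension_def odd_restriction_def)
    also have "\<dots> = f d"
      using odd d False by (simp add: odd_on_def sgn_if abs_if)
    finally show ?thesis .
  qed (use odd_on_zero[OF odd D(2)] D(2) in \<open>simp add: odd_extension_def odd_restriction_def\<close>)
qed (use ext in \<open>simp_all add: odd_extension_def odd_restriction_def\<close>)

lemma odd_restriction_odd_extension:
  assumes p: "p \<in> positives D \<rightarrow>\<^sub>E positives A" and S: "S \<subseteq> positives D"
  shows "odd_restriction D (odd_extension D (p, S)) = (p, S)"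
proof -
  have "odd_extension D (p, S) d < 0 \<longleftrightarrow> d \<in> S" if "d \<in> positives D" for d
    using that p by (auto simp: odd_extension_def positives_def PiE_def Pi_def)
  moreover have "(\<lambda>d\<in>positives D. \<bar>odd_extension D (p, S) d\<bar>) = p"
    using p by (intro extensionalityI[of _ "positives D"]) (auto simp: abs_odd_extension PiE_def)
  ultimately show ?thesis
    using S by (auto simp: odd_restriction_def)
qed

lemma bij_betw_odd_extension:
  assumes D: "symmetric_set D" "0 \<in> D" and A: "symmetric_set A" "0 \<in> A"
    and even: "\<And>a. \<kappa> (- a) = \<kappa> a"
  shows "bij_betw (odd_extension D)
    (bijections_preserving \<kappa> (positives D) (positives A) \<times> Pow (positives D))
    (odd_bijections \<kappa> D A)"
    (is "bij_betw _ ?B _")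
proof (rule bij_betwI)
  show "odd_extension D \<in> ?B \<rightarrow> odd_bijections \<kappa> D A"
    using odd_extension_mem_odd_bijections[OF D A] even by auto
  show "odd_restriction D \<in> odd_bijections \<kappa> D A \<rightarrow> ?B"
    using odd_restriction_mem_bijections_preserving[OF D A(1)] even by auto
  show "odd_extension D (odd_restriction D f) = f" if "f \<in> odd_bijections \<kappa> D A" for f
    using that by (intro odd_extension_odd_restriction[OF D])
      (auto simp: odd_bijections_def bijections_preserving_def bijections_def PiE_def)
  show "odd_restriction D (odd_extension D x) = x" if "x \<in> ?B" for x
    using that
    by (cases x) (auto simp: bijections_preserving_def bijections_def odd_restriction_odd_extension)
qed

lemma card_odd_bijections:
  fixes \<kappa> :: "'a :: linordered_idom \<Rightarrow> 'b :: finite"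
  assumes "symmetric_set D" "odd (card D)" "symmetric_set A" "odd (card A)"
    and even: "\<And>a. \<kappa> (- a) = \<kappa> a"
    and "\<And>c. card (fiber \<kappa> (positives D) c) = card (fiber \<kappa> (positives A) c)"
  shows "card (odd_bijections \<kappa> D A) =
    (\<Prod>c\<in>UNIV. fact (card (fiber \<kappa> (positives A) c))) * 2 ^ (card D div 2)"
proof -
  have finite: "finite (positives D)" "finite (positives A)"
    using assms(2,4) by (simp_all add: finite_positives finite_if_odd_card)
  have "card (odd_bijections \<kappa> D A) =
      card (bijections_preserving \<kappa> (positives D) (positives A) \<times> Pow (positives D))"
    using bij_betw_same_card[OF bij_betw_odd_extension[of D A \<kappa>]] assms(1-5)
    by (simp add: odd_symmetric_set)
  thus ?thesis
    using assms(1,2,6) finite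
    by (simp add: card_cartesian_product card_Pow card_bijections_preserving odd_symmetric_set)
qed

definition parity_sign :: "int \<Rightarrow> int" where
  "parity_sign a = (if even a then 1 else - 1)"

lemma parity_sign_add: "parity_sign (a + b) = parity_sign a * parity_sign b"
  by (simp add: parity_sign_def)

definition parity_balanced :: "int set \<Rightarrow> bool" where
  "parity_balanced A \<longleftrightarrow> \<bar>sum parity_sign A\<bar> = 1"

lemma card_fiber_even_positives:
  assumes "symmetric_set A" "odd (card A)" "parity_balanced A"
  shows "card (fiber even (positives A) True) = card A div 4"
    "card (fiber even (positives A) False) = (card A + 1) div 4"
proof -
  let ?P = "positives A"
  let ?E = "fiber even ?P True" and ?O = "fiber even ?P False"
  have finite: "finite A" "finite ?P"
    using assms(2) by (simp_all add: finite_if_odd_card finite_positives)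
  have P: "?P = ?E \<union> ?O" and disjoint: "?E \<inter> ?O = {}"
    by (auto simp: fiber_def)
  have "finite ?E" "finite ?O"
    using finite(2) by (simp_all add: fiber_def)
  hence card_P: "card ?P = card ?E + card ?O"
    and sum_P: "sum parity_sign ?P = sum parity_sign ?E + sum parity_sign ?O"
    using P disjoint by (metis card_Un_disjoint, metis sum.union_disjoint)
  have "sum parity_sign A = 1 + 2 * sum parity_sign ?P"
    using sum_symmetric_set[OF finite(1) assms(1), of parity_sign]
      odd_symmetric_set(1)[OF assms(1,2)]
    by (simp add: parity_sign_def)
  also have "sum parity_sign ?P = int (card ?E) - int (card ?O)"
    unfolding sum_P by (simp add: parity_sign_def fiber_def)
  finally have "1 + 2 * (int (card ?E) - int (card ?O)) \<in> {1, - 1}"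
    using assms(3) by (auto simp: parity_balanced_def abs_if split: if_splits)
  hence "card ?O = card ?E \<or> card ?O = card ?E + 1"
    by auto
  moreover have "card A = 2 * (card ?E + card ?O) + 1"
    using odd_symmetric_set(2)[OF assms(1,2)] assms(2) card_P by simp
  ultimately show "card ?E = card A div 4" "card ?O = (card A + 1) div 4"
    by auto
qed

lemma card_odd_bijections_const:
  assumes "symmetric_set D" "symmetric_set A" "odd (card A)" "card D = card A"
  shows "card (odd_bijections (\<lambda>_. True) D A) = fact (card A div 2) * 2 ^ (card A div 2)"
proof -
  have fiber: "fiber (\<lambda>_. True) S c = (if c then S else {})" for S :: "'a set" and c
    by (simp add: fiber_def)
  show ?thesis
    using assms by (subst card_odd_bijections) (auto simp: UNIV_bool fiber odd_symmetric_set)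
qed

lemma beta_eq:
  assumes "odd m"
  shows "beta m = fact (m div 4) * fact ((m + 1) div 4)"
proof -
  have "m mod 4 = 1 \<or> m mod 4 = 3"
    using assms by presburger
  then obtain t where "m = 4 * t + 1 \<or> m = 4 * t + 3"
    by (metis mult_div_mod_eq)
  thus ?thesis
  proof
    assume "m = 4 * t + 1"
    hence "m mod 4 = 1" "(m - 1) div 4 = t" "m div 4 = t" "(m + 1) div 4 = t"
      by presburger+
    thus ?thesis
      by (simp add: beta_def power2_eq_square)
  next
    assume "m = 4 * t + 3"
    hence "m mod 4 = 3" "(m - 3) div 4 = t" "m div 4 = t"
      by presburger+
    thus ?thesis
      by (simp add: beta_def)
  qed
qed

lemma card_odd_bijections_even:
  assumes D: "symmetric_set D" "odd (card D)" "parity_balanced D"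
    and A: "symmetric_set A" "odd (card A)" "parity_balanced A"
    and "card D = card A"
  shows "card (odd_bijections even D A) = beta (card A) * 2 ^ (card A div 2)"
proof -
  have "card (fiber even (positives D) c) = card (fiber even (positives A) c)" for c
    using card_fiber_even_positives[OF D] card_fiber_even_positives[OF A] assms(7)
    by (cases c) simp_all
  thus ?thesis
    using card_odd_bijections[of D A even] card_fiber_even_positives[OF A] assms
    by (simp add: UNIV_bool beta_eq)
qed

section \<open>Symmetric tilings of an interval\<close>

definition centered :: "nat \<Rightarrow> int set" where
  "centered n = {s. 2 * \<bar>s\<bar> < int n}"

lemma centered_odd: "odd n \<Longrightarrow> centered n = {- int (n div 2)..int (n div 2)}"
  by (auto simp: centered_def elim!: oddE)

lemma finite_centered: "finite (centered n)"
  by (rule finite_subset[of _ "{- int n..int n}"]) (auto simp: centered_def)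

lemma card_centered: "odd n \<Longrightarrow> card (centered n) = n"
  by (auto simp: centered_odd elim!: oddE)

lemma zero_mem_centered_iff: "0 \<in> centered n \<longleftrightarrow> n > 0"
  by (simp add: centered_def)

lemma symmetric_centered: "symmetric_set (centered n)"
  by (simp add: symmetric_set_def centered_def)

lemma parity_balanced_centered:
  assumes "odd n"
  shows "parity_balanced (centered n)"
proof -
  have "sum parity_sign {- int k..int k} = parity_sign (int k)" for k
  proof (induction k)
    case (Suc k)
    have "{- int (Suc k)..int (Suc k)} = insert (int k + 1) (insert (- int k - 1) {- int k..int k})"
      by auto
    thus ?case
      using Suc by (simp add: parity_sign_def)
  qed (simp add: parity_sign_def)
  thus ?thesis
    using assms by (simp add: parity_balanced_def centered_odd parity_sign_def)
qed

lemma centered_digit_unique: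
  assumes "s \<in> centered x" "s' \<in> centered x" "s + int x * t = s' + int x * t'"
  shows "s = s'" "t = t'"
proof -
  have x: "int x > 0"
    using assms(1) by (auto simp: centered_def)
  have eq: "s - s' = int x * (t' - t)"
    using assms(3) by (simp add: algebra_simps)
  moreover have "\<bar>s - s'\<bar> < int x"
    using assms(1,2) by (auto simp: centered_def)
  ultimately have "\<bar>t' - t\<bar> < 1"
    using x by (simp add: abs_mult)
  thus "s = s'" "t = t'"
    using eq by auto
qed

lemma inj_on_centered_digits: "inj_on (\<lambda>(s, t). s + int x * t) (centered x \<times> T)"
  by (rule inj_onI, clarsimp) (metis centered_digit_unique)

lemma bij_betw_centered_digits:
  assumes "odd x" "odd n"
  shows "bij_betw (\<lambda>(s, t). s + int x * t) (centered x \<times> centered n) (centered (x * n))"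
proof -
  have "(\<lambda>(s, t). s + int x * t) ` (centered x \<times> centered n) \<subseteq> centered (x * n)"
  proof clarify
    fix s t
    assume s: "s \<in> centered x" and t: "t \<in> centered n"
    hence "int x * (2 * \<bar>t\<bar> + 1) \<le> int x * int n"
      by (intro mult_left_mono) (auto simp: centered_def)
    moreover have "\<bar>s + int x * t\<bar> \<le> \<bar>s\<bar> + int x * \<bar>t\<bar>"
      using abs_triangle_ineq[of s "int x * t"] by (simp add: abs_mult)
    ultimately show "s + int x * t \<in> centered (x * n)"
      using s by (simp add: centered_def algebra_simps)
  qed
  moreover have "card (centered x \<times> centered n) = card (centered (x * n))"
    using assms by (simp add: card_cartesian_product card_centered)
  ultimately show ?thesis
    using inj_on_centered_digits[of x "centered n"]
    by (simp add: bij_betw_def card_subset_eq card_image finite_centered)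
qed

fun left_tile :: "nat list \<Rightarrow> int set" and right_tile :: "nat list \<Rightarrow> int set" where
  "left_tile [] = {0}"
| "right_tile [] = {0}"
| "left_tile (x # xs) = (\<lambda>(s, b). s + int x * b) ` (centered x \<times> right_tile xs)"
| "right_tile (x # xs) = (*) (int x) ` left_tile xs"

fun left_prod :: "'a :: comm_monoid_mult list \<Rightarrow> 'a" and right_prod :: "'a list \<Rightarrow> 'a" where
  "left_prod [] = 1"
| "right_prod [] = 1"
| "left_prod (x # xs) = x * right_prod xs"
| "right_prod (x # xs) = left_prod xs"

lemma left_right_prod_eq:
  "left_prod xs = (\<Prod>i<(length xs + 1) div 2. xs ! (2 * i))"
  "right_prod xs = (\<Prod>i<length xs div 2. xs ! (2 * i + 1))"
proof (induction xs)
  case (Cons x xs)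
  have "(length (x # xs) + 1) div 2 = Suc (length xs div 2)"
    by simp
  hence "(\<Prod>i<(length (x # xs) + 1) div 2. (x # xs) ! (2 * i)) =
      x * (\<Prod>i<length xs div 2. xs ! (2 * i + 1))"
    by (simp only: prod.lessThan_Suc_shift) simp
  thus "left_prod (x # xs) = (\<Prod>i<(length (x # xs) + 1) div 2. (x # xs) ! (2 * i))"
    "right_prod (x # xs) = (\<Prod>i<length (x # xs) div 2. (x # xs) ! (2 * i + 1))"
    using Cons by simp_all
qed simp_all

lemma prod_list_left_right: "prod_list xs = left_prod xs * right_prod xs"
  by (induction xs) (simp_all add: ac_simps)

lemma proj_factorization_seqs_eq:
  "proj_factorization_seqs m n =
     {xs. (\<forall>x\<in>set xs. x > 1) \<and> 2 \<le> length xs \<and> left_prod xs = m \<and> right_prod xs = n}"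
proof -
  have "(\<exists>k\<ge>1. length xs = 2 * k \<and> m = (\<Prod>i<k. xs ! (2 * i)) \<and> n = (\<Prod>i<k. xs ! (2 * i + 1)) \<or>
      length xs = 2 * k + 1 \<and> m = (\<Prod>i<k + 1. xs ! (2 * i)) \<and> n = (\<Prod>i<k. xs ! (2 * i + 1))) \<longleftrightarrow>
    2 \<le> length xs \<and> left_prod xs = m \<and> right_prod xs = n" (is "?lhs \<longleftrightarrow> ?rhs") for xs
  proof
    assume ?rhs
    moreover obtain k where k: "length xs = 2 * k \<or> length xs = 2 * k + 1"
      by (metis evenE oddE)
    ultimately show ?lhs
      by (intro exI[of _ k]) (auto simp: left_right_prod_eq)
  qed (auto simp: left_right_prod_eq)
  thus ?thesis
    by (simp add: proj_factorization_seqs_def)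
qed

lemma card_tiles:
  assumes "\<forall>x\<in>set xs. odd x"
  shows "card (left_tile xs) = left_prod xs" "card (right_tile xs) = right_prod xs"
  using assms
proof (induction xs)
  case (Cons x xs)
  {
    case 1
    thus ?case
      using Cons.IH
      by (simp add: card_image[OF inj_on_centered_digits] card_cartesian_product card_centered)
  next
    case 2
    hence "x > 0"
      by (simp add: odd_pos)
    thus ?case
      using Cons.IH 2 by (simp add: card_image inj_on_def)
  }
qed simp_all

lemma bij_betw_image_if_bij_betw_comp: "bij_betw (g \<circ> f) A B \<Longrightarrow> bij_betw g (f ` A) B"
  by (auto simp: bij_betw_def image_comp intro: inj_on_imageI)

lemma odd_prod_list: "\<forall>x\<in>set xs. odd x \<Longrightarrow> odd (prod_list xs :: nat)"
  by (induction xs) auto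

lemma bij_betw_tiles:
  assumes "\<forall>x\<in>set xs. odd x"
  shows "bij_betw (\<lambda>(a, b). a + b) (left_tile xs \<times> right_tile xs) (centered (prod_list xs))"
  using assms
proof (induction xs)
  case Nil
  show ?case
    by (auto simp: bij_betw_def centered_def)
next
  case (Cons x xs)
  let ?X = "centered x \<times> (left_tile xs \<times> right_tile xs)"
  let ?refine = "\<lambda>(s, a, b). (s + int x * b, int x * a)"
  have "bij_betw (map_prod id (\<lambda>(a, b). a + b)) ?X (centered x \<times> centered (prod_list xs))"
    using Cons by (intro bij_betw_map_prod) simp_all
  hence "bij_betw ((\<lambda>(s, t). s + int x * t) \<circ> map_prod id (\<lambda>(a, b). a + b)) ?X
      (centered (prod_list (x # xs)))"
    using bij_betw_trans bij_betw_centered_digits[of x "prod_list xs"] odd_prod_list[of xs]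
      Cons.prems
    by fastforce
  also have "(\<lambda>(s, t). s + int x * t) \<circ> map_prod id (\<lambda>(a, b). a + b) = (\<lambda>(a, b). a + b) \<circ> ?refine"
    by (auto simp: fun_eq_iff algebra_simps)
  finally have "bij_betw (\<lambda>(a, b). a + b) (?refine ` ?X) (centered (prod_list (x # xs)))"
    by (rule bij_betw_image_if_bij_betw_comp)
  also have "?refine ` ?X = left_tile (x # xs) \<times> right_tile (x # xs)"
    by force
  finally show ?case .
qed

lemma symmetric_tiles: "symmetric_set (left_tile xs)" "symmetric_set (right_tile xs)"
proof (induction xs)
  case (Cons x xs)
  show "symmetric_set (left_tile (x # xs))"
    unfolding symmetric_set_def
  proof
    fix a
    assume "a \<in> left_tile (x # xs)"
    then obtain s b where "a = s + int x * b" "s \<in> centered x" "b \<in> right_tile xs"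
      by auto
    thus "- a \<in> left_tile (x # xs)"
      using Cons symmetric_centered[of x]
      by (auto simp: symmetric_set_def intro!: image_eqI[of _ _ "(- s, - b)"])
  qed
  show "symmetric_set (right_tile (x # xs))"
    unfolding symmetric_set_def
  proof
    fix b
    assume "b \<in> right_tile (x # xs)"
    then obtain a where "b = int x * a" "a \<in> left_tile xs"
      by auto
    thus "- b \<in> right_tile (x # xs)"
      using Cons by (auto simp: symmetric_set_def intro!: image_eqI[of _ _ "- a"])
  qed
qed (simp_all add: symmetric_set_def)

lemma zero_mem_tiles: "\<forall>x\<in>set xs. x > 0 \<Longrightarrow> 0 \<in> left_tile xs \<and> 0 \<in> right_tile xs"
  by (induction xs) (auto simp: zero_mem_centered_iff intro!: image_eqI[of _ _ "(0, 0)"])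

lemma centered_subset_left_tile:
  assumes "\<forall>y\<in>set xs. y > 0"
  shows "centered x \<subseteq> left_tile (x # xs)"
proof
  fix s
  assume "s \<in> centered x"
  thus "s \<in> left_tile (x # xs)"
    using zero_mem_tiles[OF assms] by (auto intro!: image_eqI[of _ _ "(s, 0)"])
qed

lemma one_mem_left_tile:
  assumes "\<forall>y\<in>set xs. y > 1 \<and> odd y" "xs \<noteq> []"
  shows "1 \<in> left_tile xs"
proof (cases xs)
  case (Cons x ys)
  have x: "x > 1" "odd x" and ys: "\<forall>y\<in>set ys. y > 1"
    using assms(1) Cons by simp_all
  hence "1 \<in> centered x"
    by (cases "x = 2") (simp_all add: centered_def)
  moreover have "centered x \<subseteq> left_tile xs"
    unfolding Cons by (rule centered_subset_left_tile) (use ys in auto)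
  ultimately show ?thesis
    by blast
qed (use assms in simp)

lemma one_notin_right_tile: "\<forall>x\<in>set xs. x > 1 \<Longrightarrow> 1 \<notin> right_tile xs"
  by (cases xs) (auto simp: zmult_eq_1_iff dest!: sym[of 1])

lemma centered_subset_left_tile_imp_le:
  assumes "odd x" "\<forall>z\<in>set xs. z > 1" "odd y" "centered y \<subseteq> left_tile (x # xs)"
  shows "y \<le> x"
proof (rule ccontr)
  assume "\<not> y \<le> x"
  moreover from assms(1) obtain h where h: "x = 2 * h + 1"
    by (rule oddE)
  moreover have "y \<noteq> x + 1"
    using assms(1,3) by auto
  ultimately have "int h + 1 \<in> left_tile (x # xs)"
    using assms(4) by (auto simp: centered_def)
  then obtain s b where s: "int h + 1 = s + int x * b" "s \<in> centered x" and b: "b \<in> right_tile xs"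
    by auto
  have "- int h \<in> centered x" "s + int x * b = - int h + int x * 1"
    using s(1) h by (simp_all add: centered_def)
  hence "b = 1"
    using centered_digit_unique(2)[OF s(2)] by blast
  with b one_notin_right_tile[OF assms(2)] show False
    by simp
qed

lemma tiles_Cons_vimage:
  assumes "x > 0"
  shows "left_tile xs = {a. int x * a \<in> right_tile (x # xs)}"
    "right_tile xs = {b. int x * b \<in> left_tile (x # xs)}"
proof -
  show "left_tile xs = {a. int x * a \<in> right_tile (x # xs)}"
    using assms by auto
  have zero: "0 \<in> centered x"
    using assms by (simp add: zero_mem_centered_iff)
  hence "int x * b = s + int x * b' \<Longrightarrow> s \<in> centered x \<Longrightarrow> b = b'" for s b b'
    using centered_digit_unique(2)[of 0 x s b b'] by simp
  thus "right_tile xs = {b. int x * b \<in> left_tile (x # xs)}"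
    using zero by (auto intro: image_eqI[of _ _ "(0, _)"])
qed

lemma tiles_inject:
  assumes "\<forall>z\<in>set xs. z > 1 \<and> odd z" "\<forall>z\<in>set ys. z > 1 \<and> odd z"
    and "left_tile xs = left_tile ys" "right_tile xs = right_tile ys"
  shows "xs = ys"
  using assms
proof (induction xs arbitrary: ys)
  case Nil
  have "left_tile ys = {0}"
    using Nil.prems(3) by simp
  hence "1 \<notin> left_tile ys"
    by simp
  thus ?case
    using one_mem_left_tile[of ys] Nil.prems(2) by blast
next
  case (Cons x xs)
  have "ys \<noteq> []"
    using Cons.prems one_mem_left_tile[of "x # xs"] by auto
  then obtain y zs where ys: "ys = y # zs"
    by (cases ys) auto
  have x: "odd x" "\<forall>z\<in>set xs. z > 1" and y: "odd y" "\<forall>z\<in>set zs. z > 1"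
    using Cons.prems(1,2) ys by simp_all
  have "centered y \<subseteq> left_tile (x # xs)"
    unfolding Cons.prems(3) ys by (rule centered_subset_left_tile) (use y in auto)
  moreover have "centered x \<subseteq> left_tile (y # zs)"
    unfolding Cons.prems(3)[unfolded ys, symmetric]
    by (rule centered_subset_left_tile) (use x in auto)
  ultimately have "x = y"
    using x y by (meson centered_subset_left_tile_imp_le order_antisym)
  moreover have "left_tile xs = left_tile zs" "right_tile xs = right_tile zs"
    using tiles_Cons_vimage[of x xs] tiles_Cons_vimage[of y zs] Cons.prems ys \<open>x = y\<close>
    by (simp_all del: left_tile.simps right_tile.simps)
  ultimately show ?case
    using Cons.IH[of zs] Cons.prems ys by simp
qed

definition symmetric_tilings :: "nat \<Rightarrow> nat \<Rightarrow> (int set \<times> int set) set" where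
  "symmetric_tilings m n = {(A, B). symmetric_set A \<and> symmetric_set B \<and> card A = m \<and> card B = n \<and>
     bij_betw (\<lambda>(a, b). a + b) (A \<times> B) (centered (m * n))}"

lemma symmetric_tilings_swap:
  assumes "(A, B) \<in> symmetric_tilings m n"
  shows "(B, A) \<in> symmetric_tilings n m"
proof -
  have "bij_betw ((\<lambda>(a, b). a + b) \<circ> prod.swap) (B \<times> A) (centered (m * n))"
    using assms by (intro bij_betw_trans[of prod.swap _ "A \<times> B"])
      (auto simp: symmetric_tilings_def bij_betw_def)
  moreover have "(\<lambda>(a, b). a + b) \<circ> prod.swap = (\<lambda>(a :: int, b). a + b)"
    by (auto simp: fun_eq_iff)
  ultimately show ?thesis
    using assms by (simp add: symmetric_tilings_def mult.commute)
qed

lemma finite_symmetric_tilings: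
  assumes "odd m" "odd n"
  shows "finite (symmetric_tilings m n)"
proof (rule finite_subset)
  let ?C = "centered (m * n)"
  show "symmetric_tilings m n \<subseteq> Pow ?C \<times> Pow ?C"
  proof clarify
    fix A B
    assume "(A, B) \<in> symmetric_tilings m n"
    hence symmetric: "symmetric_set A" "symmetric_set B" "card A = m" "card B = n"
      and bij: "bij_betw (\<lambda>(a, b). a + b) (A \<times> B) ?C"
      by (auto simp: symmetric_tilings_def)
    have sum: "a + b \<in> ?C" if "a \<in> A" "b \<in> B" for a b
      using bij_betw_apply[OF bij, of "(a, b)"] that by simp
    have "0 \<in> A" "0 \<in> B"
      using symmetric assms by (simp_all add: odd_symmetric_set)
    thus "A \<in> Pow ?C \<and> B \<in> Pow ?C"
      using sum[of _ 0] sum[of 0] by auto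
  qed
qed (simp add: finite_centered)

lemma parity_balanced_symmetric_tilings:
  assumes "(A, B) \<in> symmetric_tilings m n" "odd m" "odd n"
  shows "parity_balanced A" "parity_balanced B"
proof -
  have "bij_betw (\<lambda>(a, b). a + b) (A \<times> B) (centered (m * n))"
    using assms(1) by (simp add: symmetric_tilings_def)
  hence "sum parity_sign (centered (m * n)) = (\<Sum>(a, b)\<in>A \<times> B. parity_sign (a + b))"
    by (simp add: sum.reindex_bij_betw[symmetric] case_prod_unfold)
  also have "\<dots> = sum parity_sign A * sum parity_sign B"
    by (simp add: parity_sign_add sum_product sum.cartesian_product)
  finally have "\<bar>sum parity_sign A * sum parity_sign B\<bar> = 1"
    using parity_balanced_centered[of "m * n"] assms(2,3) by (simp add: parity_balanced_def)
  thus "parity_balanced A" "parity_balanced B"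
    unfolding parity_balanced_def by (metis abs_zmult_eq_1 mult.commute)+
qed

lemma odd_factors_proj_factorization_seqs:
  assumes "xs \<in> proj_factorization_seqs m n" "odd m" "odd n"
  shows "\<forall>x\<in>set xs. x > 1 \<and> odd x"
proof
  fix x
  assume "x \<in> set xs"
  hence "x dvd m * n"
    using assms(1) prod_list_dvd[of x xs]
    by (simp add: proj_factorization_seqs_eq prod_list_left_right)
  hence "odd x"
    using assms(2,3) by (meson dvd_trans even_mult_iff)
  thus "x > 1 \<and> odd x"
    using assms(1) \<open>x \<in> set xs\<close> by (simp add: proj_factorization_seqs_eq)
qed

lemma tiles_mem_symmetric_tilings:
  assumes "xs \<in> proj_factorization_seqs m n" "odd m" "odd n"
  shows "(left_tile xs, right_tile xs) \<in> symmetric_tilings m n"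
proof -
  have odd: "\<forall>x\<in>set xs. odd x"
    using odd_factors_proj_factorization_seqs[OF assms] by simp
  show ?thesis
    using assms(1) bij_betw_tiles[OF odd] card_tiles[OF odd] symmetric_tiles[of xs]
    by (simp add: symmetric_tilings_def proj_factorization_seqs_eq prod_list_left_right)
qed

lemma card_symmetric_tilings_ge:
  assumes "odd m" "odd n"
  shows "tau m n + tau n m \<le> card (symmetric_tilings m n)"
proof -
  let ?tiles = "\<lambda>xs. (left_tile xs, right_tile xs)"
  let ?tiles' = "\<lambda>xs. (right_tile xs, left_tile xs)"
  let ?S = "proj_factorization_seqs m n" and ?S' = "proj_factorization_seqs n m"
  note factors = odd_factors_proj_factorization_seqs[OF _ assms]
    odd_factors_proj_factorization_seqs[OF _ assms(2,1)]
  have "inj_on ?tiles ?S" "inj_on ?tiles' ?S'"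
    by (rule inj_onI, use factors tiles_inject in auto)+
  hence card: "card (?tiles ` ?S) = tau m n" "card (?tiles' ` ?S') = tau n m"
    by (simp_all add: tau_def card_image)
  have subset: "?tiles ` ?S \<union> ?tiles' ` ?S' \<subseteq> symmetric_tilings m n"
    using tiles_mem_symmetric_tilings assms by (auto intro: symmetric_tilings_swap)
  hence "finite (?tiles ` ?S \<union> ?tiles' ` ?S')"
    by (rule finite_subset) (rule finite_symmetric_tilings[OF assms])
  moreover have "?tiles ` ?S \<inter> ?tiles' ` ?S' = {}"
  proof -
    have "1 \<in> left_tile xs \<and> 1 \<notin> right_tile xs" if "xs \<in> ?S \<union> ?S'" for xs
    proof -
      have "\<forall>x\<in>set xs. x > 1 \<and> odd x" "xs \<noteq> []"
        using that factors by (blast, auto simp: proj_factorization_seqs_eq)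
      thus ?thesis
        by (simp add: one_mem_left_tile one_notin_right_tile)
    qed
    thus ?thesis
      by blast
  qed
  ultimately have "tau m n + tau n m = card (?tiles ` ?S \<union> ?tiles' ` ?S')"
    by (simp add: card card_Un_disjoint)
  also have "\<dots> \<le> card (symmetric_tilings m n)"
    by (rule card_mono[OF finite_symmetric_tilings[OF assms] subset])
  finally show ?thesis .
qed

section \<open>Face sums in centered coordinates\<close>

lemma proj_C4_faces_subset:
  "m > 0 \<Longrightarrow> n > 0 \<Longrightarrow> F \<in> proj_C4_faces m n \<Longrightarrow> F \<subseteq> proj_vertices m n"
  unfolding proj_C4_faces_def proj_vertices_def by auto

lemma proj_C4_facesE:
  assumes "F \<in> proj_C4_faces m n"
  obtains (inner) i j where "F = {(i, j), (i + 1, j), (i, j + 1), (i + 1, j + 1)}"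
      "i \<in> {1..<m}" "j \<in> {1..<n}"
    | (right) i where "F = {(i, n), (i + 1, n), (m + 1 - i, 1), (m - i, 1)}" "i \<in> {1..<m}"
    | (bottom) j where "F = {(m, j), (m, j + 1), (1, n + 1 - j), (1, n - j)}" "j \<in> {1..<n}"
  using assms unfolding proj_C4_faces_def by fastforce

lemma sum_proj_C4_face:
  fixes f :: "nat \<times> nat \<Rightarrow> 'a :: comm_monoid_add"
  assumes gt_1: "m > 1" "n > 1"
    and inner: "\<And>i j. i \<in> {1..<m} \<Longrightarrow> j \<in> {1..<n} \<Longrightarrow>
      f (i, j) + f (i + 1, j) + f (i, j + 1) + f (i + 1, j + 1) = s"
    and antipodal: "\<And>i j i' j'. (i, j) \<in> proj_vertices m n \<Longrightarrow> (i', j') \<in> proj_vertices m n \<Longrightarrow>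
      odd (i + j + i' + j') \<Longrightarrow>
      f (i, j) + f (i', j') + f (m + 1 - i, n + 1 - j) + f (m + 1 - i', n + 1 - j') = s"
    and F: "F \<in> proj_C4_faces m n"
  shows "sum f F = s"
proof -
  have sum_insert4: "sum f {u, v, w, x} = f u + f v + f w + f x"
    if "distinct [u, v, w, x]" for u v w x
    using that by (simp add: add.assoc)
  from F show ?thesis
  proof (cases rule: proj_C4_facesE)
    case (inner i j)
    have "sum f F = f (i, j) + f (i + 1, j) + f (i, j + 1) + f (i + 1, j + 1)"
      unfolding inner(1) by (rule sum_insert4) simp
    thus ?thesis
      using assms(3) inner(2,3) by simp
  next
    case (right i)
    have "sum f F = f (i, n) + f (i + 1, n) + f (m + 1 - i, 1) + f (m - i, 1)"
      unfolding right(1) by (rule sum_insert4) (use gt_1 right(2) in auto)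
    moreover have "odd (i + n + (i + 1) + n)"
      by presburger
    ultimately show ?thesis
      using antipodal[of i n "i + 1" n] gt_1 right(2) by (simp add: proj_vertices_def)
  next
    case (bottom j)
    have "sum f F = f (m, j) + f (m, j + 1) + f (1, n + 1 - j) + f (1, n - j)"
      unfolding bottom(1) by (rule sum_insert4) (use gt_1 bottom(2) in auto)
    moreover have "odd (m + j + m + (j + 1))"
      by presburger
    ultimately show ?thesis
      using antipodal[of m j m "j + 1"] gt_1 bottom(2) by (simp add: proj_vertices_def)
  qed
qed

definition offset :: "nat \<Rightarrow> nat \<Rightarrow> int" where
  "offset n i = int i - int ((n + 1) div 2)"

lemma offset_Suc: "offset n (i + 1) = offset n i + 1"
  by (simp add: offset_def)

lemma offset_reflect: "odd n \<Longrightarrow> i \<le> n + 1 \<Longrightarrow> offset n (n + 1 - i) = - offset n i"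
  by (elim oddE) (simp add: offset_def)

lemma bij_betw_offset:
  assumes "odd n"
  shows "bij_betw (offset n) {1..n} (centered n)"
proof -
  obtain k where n: "n = 2 * k + 1"
    using assms by (rule oddE)
  show ?thesis
    by (rule bij_betw_byWitness[where f' = "\<lambda>d. nat (d + int k + 1)"])
      (auto simp: n offset_def centered_odd)
qed

lemma bij_betw_offsets:
  assumes "odd m" "odd n"
  shows "bij_betw (map_prod (offset m) (offset n)) (proj_vertices m n) (centered m \<times> centered n)"
  unfolding proj_vertices_def by (intro bij_betw_map_prod bij_betw_offset assms)

definition centered_labeling :: "nat \<Rightarrow> nat \<Rightarrow> (int \<times> int \<Rightarrow> int) \<Rightarrow> nat \<times> nat \<Rightarrow> nat" where
  "centered_labeling m n L =
     restrict (nat \<circ> L \<circ> map_prod (offset m) (offset n)) (proj_vertices m n)"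

lemma bij_betw_centered_labeling:
  assumes "odd m" "odd n" "bij_betw L (centered m \<times> centered n) {1..int (m * n)}"
  shows "bij_betw (centered_labeling m n L) (proj_vertices m n) {1..m * n}"
proof -
  have "bij_betw nat {1..int (m * n)} {1..m * n}"
    by (rule bij_betw_byWitness[where f' = int]) (auto simp: nat_le_iff simp flip: of_nat_mult)
  with bij_betw_offsets[OF assms(1,2)] assms(3) show ?thesis
    unfolding centered_labeling_def by (auto intro!: bij_betw_trans simp: comp_assoc)
qed

lemma int_centered_labeling:
  assumes "odd m" "odd n" "bij_betw L (centered m \<times> centered n) {1..int (m * n)}"
    and "(i, j) \<in> proj_vertices m n"
  shows "int (centered_labeling m n L (i, j)) = L (offset m i, offset n j)"
proof -
  have "(offset m i, offset n j) \<in> centered m \<times> centered n"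
    using bij_betw_apply[OF bij_betw_offsets[OF assms(1,2)] assms(4)] by simp
  hence "L (offset m i, offset n j) \<ge> 1"
    using bij_betw_apply[OF assms(3)] by fastforce
  thus ?thesis
    using assms(4) by (simp add: centered_labeling_def)
qed

definition face_balanced :: "nat \<Rightarrow> nat \<Rightarrow> (int \<times> int \<Rightarrow> int) \<Rightarrow> int \<Rightarrow> bool" where
  "face_balanced m n L s \<longleftrightarrow>
     (\<forall>d e. {d, d + 1} \<subseteq> centered m \<longrightarrow> {e, e + 1} \<subseteq> centered n \<longrightarrow>
        L (d, e) + L (d + 1, e) + L (d, e + 1) + L (d + 1, e + 1) = s) \<and>
     (\<forall>d e d' e'. {d, d'} \<subseteq> centered m \<longrightarrow> {e, e'} \<subseteq> centered n \<longrightarrow> odd (d + e + d' + e') \<longrightarrow>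
        L (d, e) + L (d', e') + L (- d, - e) + L (- d', - e') = s)"

lemma odd_offset_sum_iff:
  "odd (offset m i + offset n j + offset m i' + offset n j') \<longleftrightarrow> odd (i + j + i' + j')"
proof -
  have "offset m i + offset n j + offset m i' + offset n j' =
      int (i + j + i' + j') - 2 * int ((m + 1) div 2 + (n + 1) div 2)"
    by (simp add: offset_def)
  thus ?thesis
    by (simp only: even_diff even_add even_mult_iff even_numeral even_of_nat simp_thms)
qed

lemma sum_proj_C4_face_if_face_balanced:
  assumes odd_mn: "odd m" "odd n" and gt_1: "m > 1" "n > 1"
    and L: "face_balanced m n L s" and F: "F \<in> proj_C4_faces m n"
  shows "(\<Sum>(i, j)\<in>F. L (offset m i, offset n j)) = s"
proof (rule sum_proj_C4_face[OF gt_1 _ _ F])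
  have mem: "offset m i \<in> centered m" "offset n j \<in> centered n"
    if "(i, j) \<in> proj_vertices m n" for i j
    using bij_betw_apply[OF bij_betw_offsets[OF odd_mn] that] by simp_all
  let ?f = "\<lambda>(i, j). L (offset m i, offset n j)"
  show "?f (i, j) + ?f (i + 1, j) + ?f (i, j + 1) + ?f (i + 1, j + 1) = s"
    if "i \<in> {1..<m}" "j \<in> {1..<n}" for i j
    using L mem[of i j] mem[of "i + 1" "j + 1"] that
    by (simp add: face_balanced_def proj_vertices_def offset_Suc[simplified])
  show "?f (i, j) + ?f (i', j') + ?f (m + 1 - i, n + 1 - j) + ?f (m + 1 - i', n + 1 - j') = s"
    if v: "(i, j) \<in> proj_vertices m n" "(i', j') \<in> proj_vertices m n"
      and parity: "odd (i + j + i' + j')" for i j i' j'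
  proof -
    have "offset m (m + 1 - i) = - offset m i" "offset n (n + 1 - j) = - offset n j"
      "offset m (m + 1 - i') = - offset m i'" "offset n (n + 1 - j') = - offset n j'"
      using v offset_reflect[OF odd_mn(1)] offset_reflect[OF odd_mn(2)]
      by (simp_all add: proj_vertices_def)
    moreover have "odd (offset m i + offset n j + offset m i' + offset n j')"
      by (rule odd_offset_sum_iff[THEN iffD2, OF parity])
    ultimately show ?thesis
      using L mem[OF v(1)] mem[OF v(2)] unfolding face_balanced_def by simp
  qed
qed

lemma centered_labeling_magic:
  assumes odd_mn: "odd m" "odd n" and gt_1: "m > 1" "n > 1"
    and bij: "bij_betw L (centered m \<times> centered n) {1..int (m * n)}" and L: "face_balanced m n L s"
  shows "centered_labeling m n L \<in> C4_face_magic_labelings m n"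
proof -
  have "(\<Sum>v\<in>F. centered_labeling m n L v) = nat s" if F: "F \<in> proj_C4_faces m n" for F
  proof -
    have "F \<subseteq> proj_vertices m n"
      using gt_1 by (intro proj_C4_faces_subset[OF _ _ F]) simp_all
    hence "int (\<Sum>v\<in>F. centered_labeling m n L v) = (\<Sum>(i, j)\<in>F. L (offset m i, offset n j))"
      unfolding of_nat_sum
      by (intro sum.cong) (use int_centered_labeling[OF odd_mn bij] in auto)
    also have "\<dots> = s"
      by (rule sum_proj_C4_face_if_face_balanced[OF odd_mn gt_1 L F])
    finally show ?thesis
      by (metis nat_int)
  qed
  moreover have "centered_labeling m n L \<in> extensional (proj_vertices m n)"
    by (simp add: centered_labeling_def)
  ultimately show ?thesis
    using bij_betw_centered_labeling[OF odd_mn bij]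
    unfolding C4_face_magic_labelings_def by blast
qed

lemma centered_labeling_inject:
  assumes "odd m" "odd n"
    and L: "bij_betw L (centered m \<times> centered n) {1..int (m * n)}"
    and L': "bij_betw L' (centered m \<times> centered n) {1..int (m * n)}"
    and eq: "centered_labeling m n L = centered_labeling m n L'"
    and v: "v \<in> centered m \<times> centered n"
  shows "L v = L' v"
proof -
  obtain i j where "(i, j) \<in> proj_vertices m n" "v = (offset m i, offset n j)"
    using v bij_betw_imp_surj_on[OF bij_betw_offsets[OF assms(1,2)]] by (force simp: image_iff)
  thus ?thesis
    using int_centered_labeling[OF assms(1,2) L] int_centered_labeling[OF assms(1,2) L'] eq
    by metis
qed

section \<open>Labelings from tilings\<close>

text \<open>Labels, and with them \<open>p\<close>, \<open>q\<close> and \<open>w\<close>, are doubled, so that the half-integral weight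
  \<open>w = 1/2\<close> stays in the integers.\<close>

definition twice_label ::
    "int \<times> int \<times> int \<Rightarrow> (int \<Rightarrow> int) \<Rightarrow> (int \<Rightarrow> int) \<Rightarrow> int \<times> int \<Rightarrow> int" where
  "twice_label = (\<lambda>(p, q, w) \<alpha> \<beta> (d, e).
     if even (d + e) then p + w * (\<alpha> d + \<beta> e) else q - w * (\<alpha> d + \<beta> e))"

definition tile_label ::
    "int \<times> int \<times> int \<Rightarrow> (int \<Rightarrow> int) \<Rightarrow> (int \<Rightarrow> int) \<Rightarrow> int \<times> int \<Rightarrow> int" where
  "tile_label c \<alpha> \<beta> v = twice_label c \<alpha> \<beta> v div 2"

lemma twice_label_inner_sum:
  "twice_label (p, q, w) \<alpha> \<beta> (d, e) + twice_label (p, q, w) \<alpha> \<beta> (d + 1, e) +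
    twice_label (p, q, w) \<alpha> \<beta> (d, e + 1) + twice_label (p, q, w) \<alpha> \<beta> (d + 1, e + 1) = 2 * (p + q)"
  by (simp add: twice_label_def algebra_simps)

lemma twice_label_antipodal_sum:
  assumes "odd_on D \<alpha>" "odd_on E \<beta>" "d \<in> D" "e \<in> E"
  shows "twice_label (p, q, w) \<alpha> \<beta> (d, e) + twice_label (p, q, w) \<alpha> \<beta> (- d, - e) =
    (if even (d + e) then 2 * p else 2 * q)"
  using assms by (simp add: twice_label_def odd_on_def algebra_simps)

lemma face_balanced_tile_label:
  assumes odd: "odd_on (centered m) \<alpha>" "odd_on (centered n) \<beta>"
    and even: "\<And>v. v \<in> centered m \<times> centered n \<Longrightarrow> even (twice_label (p, q, w) \<alpha> \<beta> v)"
  shows "face_balanced m n (tile_label (p, q, w) \<alpha> \<beta>) (p + q)"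
proof -
  let ?L = "tile_label (p, q, w) \<alpha> \<beta>"
  have twice: "2 * ?L (d, e) = twice_label (p, q, w) \<alpha> \<beta> (d, e)"
    if "d \<in> centered m" "e \<in> centered n" for d e
    using even[of "(d, e)"] that by (simp add: tile_label_def)
  have "?L (d, e) + ?L (d + 1, e) + ?L (d, e + 1) + ?L (d + 1, e + 1) = p + q"
    if "{d, d + 1} \<subseteq> centered m" "{e, e + 1} \<subseteq> centered n" for d e
  proof -
    have "2 * (?L (d, e) + ?L (d + 1, e) + ?L (d, e + 1) + ?L (d + 1, e + 1)) = 2 * (p + q)"
      using that twice_label_inner_sum[of p q w \<alpha> \<beta> d e] by (simp add: twice)
    thus ?thesis
      by simp
  qed
  moreover have "?L (d, e) + ?L (d', e') + ?L (- d, - e) + ?L (- d', - e') = p + q"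
    if "{d, d'} \<subseteq> centered m" "{e, e'} \<subseteq> centered n" and parity: "odd (d + e + d' + e')"
    for d e d' e'
  proof -
    have mem: "d \<in> centered m" "d' \<in> centered m" "e \<in> centered n" "e' \<in> centered n"
      using that by simp_all
    have "even (d + e) \<noteq> even (d' + e')"
      using parity by presburger
    hence "2 * (?L (d, e) + ?L (d', e') + ?L (- d, - e) + ?L (- d', - e')) = 2 * (p + q)"
      using twice_label_antipodal_sum[OF odd mem(1,3), of p q w]
        twice_label_antipodal_sum[OF odd mem(2,4), of p q w]
      by (simp only: distrib_left twice mem uminus_mem_symmetric_set[OF symmetric_centered])
        (auto split: if_splits)
    thus ?thesis
      by simp
  qed
  ultimately show ?thesis
    by (simp add: face_balanced_def)
qed

definition plain_offset :: "int \<Rightarrow> int \<times> int \<times> int" where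
  "plain_offset N = (2 * N + 2, 2 * N + 2, 2)"

text \<open>The first triple sends the even sums onto \<open>{1..N + 1}\<close> and the odd sums onto
  \<open>{N + 2..2N + 1}\<close>; the second sends them onto \<open>{N + 1..2N + 1}\<close> and \<open>{1..N}\<close>.\<close>

definition split_offsets :: "int \<Rightarrow> (int \<times> int \<times> int) set" where
  "split_offsets N = {(N + 2, 3 * N + 3, 1), (3 * N + 2, N + 1, 1)}"

lemma bij_betw_plain_label:
  assumes symmetric: "symmetric_set D" "symmetric_set E"
    and odd: "odd_on D \<alpha>" "odd_on E \<beta>"
    and sum: "bij_betw (\<lambda>(d, e). \<alpha> d + \<beta> e) (D \<times> E) {- N..N}"
  shows "bij_betw (tile_label (plain_offset N) \<alpha> \<beta>) (D \<times> E) {1..2 * N + 1}"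
proof -
  let ?flip = "\<lambda>(d, e). if even (d + e) then (d, e) else (- d, - e)"
  have "bij_betw ?flip (D \<times> E) (D \<times> E)"
    by (rule bij_betw_byWitness[where f' = ?flip])
      (use symmetric in \<open>auto simp: symmetric_set_def split: if_splits\<close>)
  moreover have "bij_betw (\<lambda>v. N + 1 + v) {- N..N} {1..2 * N + 1}"
    by (rule bij_betw_byWitness[where f' = "\<lambda>v. v - N - 1"]) auto
  ultimately have "bij_betw ((\<lambda>v. N + 1 + v) \<circ> ((\<lambda>(d, e). \<alpha> d + \<beta> e) \<circ> ?flip))
      (D \<times> E) {1..2 * N + 1}"
    using sum by (blast intro: bij_betw_trans)
  moreover have "tile_label (plain_offset N) \<alpha> \<beta> (d, e) =
      ((\<lambda>v. N + 1 + v) \<circ> ((\<lambda>(d, e). \<alpha> d + \<beta> e) \<circ> ?flip)) (d, e)" if "d \<in> D" "e \<in> E" for d e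
  proof -
    have "twice_label (plain_offset N) \<alpha> \<beta> (d, e) =
        2 * (N + 1 + (if even (d + e) then \<alpha> d + \<beta> e else - (\<alpha> d + \<beta> e)))"
      by (simp add: twice_label_def plain_offset_def)
    thus ?thesis
      using odd that by (simp add: tile_label_def odd_on_def)
  qed
  ultimately show ?thesis
    by (subst bij_betw_cong) auto
qed

lemma bij_betw_split_label:
  assumes "even N" and c: "c \<in> split_offsets N"
    and parity: "\<And>d. d \<in> D \<Longrightarrow> even (\<alpha> d) \<longleftrightarrow> even d" "\<And>e. e \<in> E \<Longrightarrow> even (\<beta> e) \<longleftrightarrow> even e"
    and sum: "bij_betw (\<lambda>(d, e). \<alpha> d + \<beta> e) (D \<times> E) {- N..N}"
  shows "bij_betw (tile_label c \<alpha> \<beta>) (D \<times> E) {1..2 * N + 1}"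
proof -
  obtain M where N: "N = 2 * M"
    using assms(1) by (rule evenE)
  obtain p q where pq: "c = (p, q, 1)"
    using c by (auto simp: split_offsets_def)
  let ?half = "\<lambda>v. (if even v then p + v else q - v) div 2"
  have "bij_betw ?half {- N..N} {1..2 * N + 1}"
  proof -
    consider (low) "p = N + 2" "q = 3 * N + 3" | (high) "p = 3 * N + 2" "q = N + 1"
      using c pq by (auto simp: split_offsets_def)
    thus ?thesis
    proof cases
      case low
      show ?thesis
        by (rule bij_betw_byWitness[where f' = "\<lambda>y. if y \<le> N + 1 then 2 * y - p else q - 2 * y"])
          (auto simp: low N elim!: evenE oddE)
    next
      case high
      show ?thesis
        by (rule bij_betw_byWitness[where f' = "\<lambda>y. if y \<le> N then q - 2 * y else 2 * y - p"])
          (auto simp: high N elim!: evenE oddE)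
    qed
  qed
  hence "bij_betw (?half \<circ> (\<lambda>(d, e). \<alpha> d + \<beta> e)) (D \<times> E) {1..2 * N + 1}"
    by (rule bij_betw_trans[OF sum])
  moreover have "tile_label c \<alpha> \<beta> (d, e) = (?half \<circ> (\<lambda>(d, e). \<alpha> d + \<beta> e)) (d, e)"
    if "d \<in> D" "e \<in> E" for d e
    using parity that by (simp add: tile_label_def twice_label_def pq)
  ultimately show ?thesis
    by (subst bij_betw_cong) auto
qed

lemma even_twice_plain_label: "even (twice_label (plain_offset N) \<alpha> \<beta> v)"
  by (cases v) (simp add: twice_label_def plain_offset_def)

lemma even_twice_split_label:
  assumes "even N" "c \<in> split_offsets N" "even (\<alpha> d) \<longleftrightarrow> even d" "even (\<beta> e) \<longleftrightarrow> even e"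
  shows "even (twice_label c \<alpha> \<beta> (d, e))"
  using assms by (auto simp: twice_label_def split_offsets_def)

lemma twice_label_inject:
  assumes "N > 0" and c: "c \<in> insert (plain_offset N) (split_offsets N)"
      "c' \<in> insert (plain_offset N) (split_offsets N)"
    and zero: "0 \<in> D" "0 \<in> E"
    and odd: "odd_on D \<alpha>" "odd_on E \<beta>" "odd_on D \<alpha>'" "odd_on E \<beta>'"
    and eq: "\<And>d e. d \<in> D \<Longrightarrow> e \<in> E \<Longrightarrow> twice_label c \<alpha> \<beta> (d, e) = twice_label c' \<alpha>' \<beta>' (d, e)"
  shows "c = c'" "d \<in> D \<Longrightarrow> \<alpha> d = \<alpha>' d" "e \<in> E \<Longrightarrow> \<beta> e = \<beta>' e"
proof -
  obtain p q w p' q' w' where pqw: "c = (p, q, w)" "c' = (p', q', w')"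
    by (cases c, cases c')
  have zero_eq: "\<alpha> 0 = 0" "\<beta> 0 = 0" "\<alpha>' 0 = 0" "\<beta>' 0 = 0"
    using odd zero odd_on_zero by blast+
  have "p = p'"
    using eq[OF zero] zero_eq by (simp add: twice_label_def pqw)
  thus "c = c'"
    using c \<open>N > 0\<close> by (auto simp: pqw plain_offset_def split_offsets_def)
  moreover have "w \<noteq> 0"
    using c(1) by (auto simp: pqw plain_offset_def split_offsets_def)
  ultimately show "\<alpha> d = \<alpha>' d" if "d \<in> D"
    using eq[OF that zero(2)] zero_eq by (simp add: twice_label_def pqw split: if_splits)
  show "\<beta> e = \<beta>' e" if "e \<in> E"
    using eq[OF zero(1) that] zero_eq \<open>c = c'\<close> \<open>w \<noteq> 0\<close>
    by (simp add: twice_label_def pqw split: if_splits)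
qed

lemma bij_betw_tile_sum:
  assumes "(A, B) \<in> symmetric_tilings m n" "odd (m * n)"
    and "bij_betw \<alpha> D A" "bij_betw \<beta> E B"
  shows "bij_betw (\<lambda>(d, e). \<alpha> d + \<beta> e) (D \<times> E) {- int (m * n div 2)..int (m * n div 2)}"
proof -
  have "bij_betw (\<lambda>(a, b). a + b) (A \<times> B) (centered (m * n))"
    using assms(1) by (simp add: symmetric_tilings_def)
  hence "bij_betw ((\<lambda>(a, b). a + b) \<circ> map_prod \<alpha> \<beta>) (D \<times> E) (centered (m * n))"
    by (rule bij_betw_trans[OF bij_betw_map_prod[OF assms(3,4)]])
  moreover have "(\<lambda>(a, b). a + b) \<circ> map_prod \<alpha> \<beta> = (\<lambda>(d, e). \<alpha> d + \<beta> e)"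
    by (simp add: fun_eq_iff)
  ultimately show ?thesis
    by (simp only: centered_odd[OF assms(2)])
qed

definition tile_bijections ::
    "(int \<Rightarrow> bool) \<Rightarrow> nat \<Rightarrow> nat \<Rightarrow> int set \<times> int set \<Rightarrow> ((int \<Rightarrow> int) \<times> (int \<Rightarrow> int)) set" where
  "tile_bijections \<kappa> m n = (\<lambda>(A, B).
     odd_bijections \<kappa> (centered m) A \<times> odd_bijections \<kappa> (centered n) B)"

lemma tile_bijectionsD:
  assumes "(\<alpha>, \<beta>) \<in> tile_bijections \<kappa> m n (A, B)"
  shows "bij_betw \<alpha> (centered m) A" "bij_betw \<beta> (centered n) B"
    and "odd_on (centered m) \<alpha>" "odd_on (centered n) \<beta>"
    and "\<alpha> \<in> extensional (centered m)" "\<beta> \<in> extensional (centered n)"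
    and "\<And>d. d \<in> centered m \<Longrightarrow> \<kappa> (\<alpha> d) = \<kappa> d" "\<And>e. e \<in> centered n \<Longrightarrow> \<kappa> (\<beta> e) = \<kappa> e"
  using assms by (auto simp: tile_bijections_def odd_bijections_def bijections_preserving_def
      bijections_def PiE_def)

definition label_params ::
    "nat \<Rightarrow> nat \<Rightarrow> int set \<times> int set \<Rightarrow> ((int \<times> int \<times> int) \<times> (int \<Rightarrow> int) \<times> (int \<Rightarrow> int)) set" where
  "label_params m n T =
     {plain_offset (int (m * n div 2))} \<times> tile_bijections (\<lambda>_. True) m n T \<union>
     split_offsets (int (m * n div 2)) \<times> tile_bijections even m n T"

lemma label_paramsE:
  assumes "(c, \<alpha>, \<beta>) \<in> label_params m n T"
  obtains \<kappa> where "(\<alpha>, \<beta>) \<in> tile_bijections \<kappa> m n T"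
    and "c \<in> insert (plain_offset (int (m * n div 2))) (split_offsets (int (m * n div 2)))"
  using assms by (auto simp: label_params_def)

lemma label_params_bij_betw_even:
  assumes T: "(A, B) \<in> symmetric_tilings m n" and mod_4: "m * n mod 4 = 1"
    and params: "(c, \<alpha>, \<beta>) \<in> label_params m n (A, B)"
  shows "bij_betw (tile_label c \<alpha> \<beta>) (centered m \<times> centered n) {1..int (m * n)}"
    and "v \<in> centered m \<times> centered n \<Longrightarrow> even (twice_label c \<alpha> \<beta> v)"
proof -
  define N where "N = int (m * n div 2)"
  have N: "even N" "2 * N + 1 = int (m * n)" and odd_mn: "odd (m * n)"
    using mod_4 unfolding N_def by presburger+
  obtain \<kappa> where "(\<alpha>, \<beta>) \<in> tile_bijections \<kappa> m n (A, B)"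
    by (rule label_paramsE[OF params])
  note tile = tile_bijectionsD[OF this]
  note sum = bij_betw_tile_sum[OF T odd_mn tile(1,2), folded N_def]
  consider (plain) "c = plain_offset N"
    | (split) "c \<in> split_offsets N" "(\<alpha>, \<beta>) \<in> tile_bijections even m n (A, B)"
    using params by (auto simp: label_params_def N_def)
  hence "bij_betw (tile_label c \<alpha> \<beta>) (centered m \<times> centered n) {1..2 * N + 1} \<and>
    (v \<in> centered m \<times> centered n \<longrightarrow> even (twice_label c \<alpha> \<beta> v))"
  proof cases
    case plain
    thus ?thesis
      using bij_betw_plain_label[OF symmetric_centered symmetric_centered tile(3,4) sum]
      by (simp add: even_twice_plain_label)
  next
    case split
    note parity = tile_bijectionsD(7,8)[OF split(2)]
    show ?thesis
      using bij_betw_split_label[OF N(1) split(1) parity sum]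
        even_twice_split_label[OF N(1) split(1)] parity
      by auto
  qed
  thus "bij_betw (tile_label c \<alpha> \<beta>) (centered m \<times> centered n) {1..int (m * n)}"
    and "v \<in> centered m \<times> centered n \<Longrightarrow> even (twice_label c \<alpha> \<beta> v)"
    by (simp_all only: N(2) simp_thms)
qed

lemma label_params_magic:
  assumes odd_mn: "odd m" "odd n" and gt_1: "m > 1" "n > 1" and mod_4: "m * n mod 4 = 1"
    and T: "(A, B) \<in> symmetric_tilings m n" and params: "(c, \<alpha>, \<beta>) \<in> label_params m n (A, B)"
  shows "centered_labeling m n (tile_label c \<alpha> \<beta>) \<in> C4_face_magic_labelings m n"
proof -
  note bij_even = label_params_bij_betw_even[OF T mod_4 params]
  obtain p q w where c: "c = (p, q, w)"
    by (cases c)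
  obtain \<kappa> where "(\<alpha>, \<beta>) \<in> tile_bijections \<kappa> m n (A, B)"
    by (rule label_paramsE[OF params])
  hence "face_balanced m n (tile_label c \<alpha> \<beta>) (p + q)"
    using bij_even(2) unfolding c by (blast intro: face_balanced_tile_label tile_bijectionsD(3,4))
  thus ?thesis
    by (rule centered_labeling_magic[OF odd_mn gt_1 bij_even(1)])
qed

lemma twice_label_eq_if_labeling_eq:
  assumes odd_mn: "odd m" "odd n" and mod_4: "m * n mod 4 = 1"
    and T: "(A, B) \<in> symmetric_tilings m n" "(A', B') \<in> symmetric_tilings m n"
    and c: "(c, \<alpha>, \<beta>) \<in> label_params m n (A, B)"
    and c': "(c', \<alpha>', \<beta>') \<in> label_params m n (A', B')"
    and eq: "centered_labeling m n (tile_label c \<alpha> \<beta>) = centered_labeling m n (tile_label c' \<alpha>' \<beta>')"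
    and v: "v \<in> centered m \<times> centered n"
  shows "twice_label c \<alpha> \<beta> v = twice_label c' \<alpha>' \<beta>' v"
proof -
  note bij_even = label_params_bij_betw_even[OF T(1) mod_4 c]
  note bij_even' = label_params_bij_betw_even[OF T(2) mod_4 c']
  have "tile_label c \<alpha> \<beta> v = tile_label c' \<alpha>' \<beta>' v"
    by (rule centered_labeling_inject[OF odd_mn bij_even(1) bij_even'(1) eq v])
  thus ?thesis
    using bij_even(2)[OF v] bij_even'(2)[OF v] unfolding tile_label_def by (auto elim!: evenE)
qed

text \<open>The label of the central vertex reveals the offsets; the labels on the central
  row and column then reveal the two bijections, and these determine the tiles.\<close>

lemma label_params_inject:
  assumes odd_mn: "odd m" "odd n" and gt_1: "m > 1" and mod_4: "m * n mod 4 = 1"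
    and T: "(A, B) \<in> symmetric_tilings m n" "(A', B') \<in> symmetric_tilings m n"
    and params: "(c, \<alpha>, \<beta>) \<in> label_params m n (A, B)"
    and params': "(c', \<alpha>', \<beta>') \<in> label_params m n (A', B')"
    and eq: "centered_labeling m n (tile_label c \<alpha> \<beta>) = centered_labeling m n (tile_label c' \<alpha>' \<beta>')"
  shows "A = A'" "B = B'" "c = c'" "\<alpha> = \<alpha>'" "\<beta> = \<beta>'"
proof -
  define N where "N = int (m * n div 2)"
  have "1 * 1 < m * n"
    using odd_mn(2) gt_1 by (intro mult_less_le_imp_less) (auto simp: odd_pos Suc_leI)
  hence "N > 0"
    by (simp add: N_def)
  obtain \<kappa> where "(\<alpha>, \<beta>) \<in> tile_bijections \<kappa> m n (A, B)"
    and c: "c \<in> insert (plain_offset N) (split_offsets N)"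
    unfolding N_def by (rule label_paramsE[OF params])
  note tile = tile_bijectionsD[OF this(1)]
  obtain \<kappa>' where "(\<alpha>', \<beta>') \<in> tile_bijections \<kappa>' m n (A', B')"
    and c': "c' \<in> insert (plain_offset N) (split_offsets N)"
    unfolding N_def by (rule label_paramsE[OF params'])
  note tile' = tile_bijectionsD[OF this(1)]
  have zero: "0 \<in> centered m" "0 \<in> centered n"
    using odd_mn by (simp_all add: zero_mem_centered_iff odd_pos)
  have "twice_label c \<alpha> \<beta> (d, e) = twice_label c' \<alpha>' \<beta>' (d, e)"
    if "d \<in> centered m" "e \<in> centered n" for d e
    using twice_label_eq_if_labeling_eq[OF odd_mn mod_4 T params params' eq] that by simp
  note inject = twice_label_inject[OF \<open>N > 0\<close> c c' zero tile(3,4) tile'(3,4) this]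
  show "c = c'"
    by (rule inject(1))
  show "\<alpha> = \<alpha>'" "\<beta> = \<beta>'"
    using inject(2,3) tile(5,6) tile'(5,6) by (blast intro: extensionalityI)+
  thus "A = A'" "B = B'"
    using tile(1,2) tile'(1,2) by (simp_all add: bij_betw_def)
qed

lemma inj_on_label_params:
  assumes "odd m" "odd n" "m > 1" "m * n mod 4 = 1"
  shows "inj_on (\<lambda>(T, c, \<alpha>, \<beta>). centered_labeling m n (tile_label c \<alpha> \<beta>))
    (Sigma (symmetric_tilings m n) (label_params m n))"
proof (rule inj_onI)
  let ?S = "Sigma (symmetric_tilings m n) (label_params m n)"
  let ?labeling = "\<lambda>(T, c, \<alpha>, \<beta>). centered_labeling m n (tile_label c \<alpha> \<beta>)"
  fix x y
  assume "x \<in> ?S" "y \<in> ?S" "?labeling x = ?labeling y"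
  moreover obtain A B c \<alpha> \<beta> where "x = ((A, B), c, \<alpha>, \<beta>)"
    by (metis prod.exhaust)
  moreover obtain A' B' c' \<alpha>' \<beta>' where "y = ((A', B'), c', \<alpha>', \<beta>')"
    by (metis prod.exhaust)
  ultimately show "x = y"
    using label_params_inject[OF assms, of A B A' B' c \<alpha> \<beta> c' \<alpha>' \<beta>'] by simp
qed

lemma card_tile_bijections:
  assumes T: "(A, B) \<in> symmetric_tilings m n" and odd_mn: "odd m" "odd n"
  shows "card (tile_bijections (\<lambda>_. True) m n (A, B)) =
      fact (m div 2) * fact (n div 2) * 2 ^ (m div 2 + n div 2)"
    and "card (tile_bijections even m n (A, B)) = beta m * beta n * 2 ^ (m div 2 + n div 2)"
  using assms parity_balanced_symmetric_tilings[OF T odd_mn]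
  by (auto simp: tile_bijections_def symmetric_tilings_def card_cartesian_product card_centered
      symmetric_centered parity_balanced_centered card_odd_bijections_const card_odd_bijections_even
      power_add)

lemma finite_tile_bijections:
  assumes T: "(A, B) \<in> symmetric_tilings m n" and odd_mn: "odd m" "odd n"
  shows "finite (tile_bijections \<kappa> m n (A, B))"
proof (rule finite_subset)
  show "tile_bijections \<kappa> m n (A, B) \<subseteq> (centered m \<rightarrow>\<^sub>E A) \<times> (centered n \<rightarrow>\<^sub>E B)"
    by (auto simp: tile_bijections_def odd_bijections_def bijections_preserving_def bijections_def)
  have "finite A" "finite B"
    using T odd_mn by (auto simp: symmetric_tilings_def intro: finite_if_odd_card)
  thus "finite ((centered m \<rightarrow>\<^sub>E A) \<times> (centered n \<rightarrow>\<^sub>E B))"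
    by (simp add: finite_PiE finite_centered)
qed

lemma card_label_params:
  assumes T: "(A, B) \<in> symmetric_tilings m n" and odd_mn: "odd m" "odd n"
  shows "finite (label_params m n (A, B))"
    and "card (label_params m n (A, B)) =
      (fact (m div 2) * fact (n div 2) + 2 * (beta m * beta n)) * 2 ^ (m div 2 + n div 2)"
proof -
  define N where "N = int (m * n div 2)"
  have finite: "finite (split_offsets N)" "finite (tile_bijections \<kappa> m n (A, B))" for \<kappa>
    using finite_tile_bijections[OF T odd_mn] by (simp_all add: split_offsets_def)
  have labels: "label_params m n (A, B) = {plain_offset N} \<times> tile_bijections (\<lambda>_. True) m n (A, B) \<union>
      split_offsets N \<times> tile_bijections even m n (A, B)"
    by (simp add: label_params_def N_def)
  show "finite (label_params m n (A, B))"
    unfolding labels using finite by simp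
  have "N \<ge> 0"
    by (simp add: N_def)
  hence "plain_offset N \<notin> split_offsets N" "card (split_offsets N) = 2"
    by (auto simp: plain_offset_def split_offsets_def)
  thus "card (label_params m n (A, B)) =
      (fact (m div 2) * fact (n div 2) + 2 * (beta m * beta n)) * 2 ^ (m div 2 + n div 2)"
    unfolding labels using finite card_tile_bijections[OF T odd_mn]
    by (subst card_Un_disjoint) (auto simp: card_cartesian_product algebra_simps)
qed

lemma card_C4_face_magic_labelings_ge:
  assumes odd_mn: "odd m" "odd n" and gt_1: "m > 1" "n > 1" and mod_4: "m * n mod 4 = 1"
  shows "card (symmetric_tilings m n) *
      ((fact (m div 2) * fact (n div 2) + 2 * (beta m * beta n)) * 2 ^ (m div 2 + n div 2))
    \<le> card (C4_face_magic_labelings m n)"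
proof -
  let ?S = "Sigma (symmetric_tilings m n) (label_params m n)"
  let ?labeling = "\<lambda>(T, c, \<alpha>, \<beta>). centered_labeling m n (tile_label c \<alpha> \<beta>)"
  let ?count = "(fact (m div 2) * fact (n div 2) + 2 * (beta m * beta n)) * 2 ^ (m div 2 + n div 2)"
  have "card ?S = (\<Sum>T\<in>symmetric_tilings m n. card (label_params m n T))"
    by (rule card_SigmaI)
      (use finite_symmetric_tilings[OF odd_mn] card_label_params(1)[OF _ odd_mn] in auto)
  also have "\<dots> = (\<Sum>T\<in>symmetric_tilings m n. ?count)"
    using card_label_params(2)[OF _ odd_mn] by (intro sum.cong) auto
  finally have "card (symmetric_tilings m n) * ?count = card (?labeling ` ?S)"
    by (simp add: card_image[OF inj_on_label_params[OF odd_mn gt_1(1) mod_4]])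
  also have "\<dots> \<le> card (C4_face_magic_labelings m n)"
    using label_params_magic[OF odd_mn gt_1 mod_4]
    by (intro card_mono finite_C4_face_magic_labelings) auto
  finally show ?thesis .
qed

lemma odd_square_mod_4:
  fixes m :: nat
  assumes "odd m"
  shows "m * m mod 4 = 1"
proof -
  obtain k where "m = 2 * k + 1"
    using assms by (rule oddE)
  hence "m * m = 1 + 4 * (k * k + k)"
    by (simp add: algebra_simps)
  thus ?thesis
    by (simp only: mod_mult_self2) simp
qed

theorem theorem45:
  fixes m :: nat
  assumes "m \<ge> 3" and "odd m"
  shows "num_labelings_up_to_symmetry m \<ge>
           tau m m * 2 ^ (m - 3) * ((fact ((m - 1) div 2))\<^sup>2 + 2 * (beta m)\<^sup>2)"
proof -
  let ?count = "(fact ((m - 1) div 2))\<^sup>2 + 2 * (beta m)\<^sup>2"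
  have half: "(m - 1) div 2 = m div 2" "m div 2 + m div 2 = m - 1"
    using assms(2) by presburger+
  have "m - 1 = Suc (Suc (m - 3))" "m > 1"
    using assms(1) by simp_all
  hence power: "(2 :: nat) ^ (m - 1) = 4 * 2 ^ (m - 3)"
    by simp
  have "card (symmetric_tilings m m) * (?count * 2 ^ (m - 1)) \<le> card (C4_face_magic_labelings m m)"
    using card_C4_face_magic_labelings_ge[of m m] odd_square_mod_4 assms half \<open>m > 1\<close>
    by (simp add: power2_eq_square)
  have "8 * (tau m m * 2 ^ (m - 3) * ?count) = (tau m m + tau m m) * (?count * 2 ^ (m - 1))"
    unfolding power by (simp add: algebra_simps)
  also have "\<dots> \<le> card (symmetric_tilings m m) * (?count * 2 ^ (m - 1))"
    by (rule mult_le_mono1[OF card_symmetric_tilings_ge[OF assms(2,2)]])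
  also have "\<dots> \<le> card (C4_face_magic_labelings m m)"
    by fact
  also have "\<dots> \<le> 8 * num_labelings_up_to_symmetry m"
    by (rule card_labelings_le)
  finally show ?thesis
    by simp
qed

end
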